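(* For any fixed $b>0$, $$\lim_{r\to\infty}\mathcal N_{\mathrm{HO}}(r)=\infty,$$ where $\mathcal N_{\mathrm{HO}}(r)=\#\left(\operatorname{Sp}(L_{\mathrm{HO}}(ir,b))\setminus\mathbb R\right)$ is the number of non-real points of the spectrum of the operator $L_{\mathrm{HO}}(ir,b)$, with $r$ real.
   Context: For $b>0$ and $z\in\mathbb C$, $L_{\mathrm{HO}}(z,b)$ is the operator in $L^2(\mathbb R)$ formally given by $L_{\mathrm{HO}}(z,b)y=-y''+x^2y+z\left(\delta(x-b)-\delta(x+b)\right)y$, where $\delta$ is the Dirac delta. Precisely, it is the operator defined by the quadratic-form method from the form $\mathfrak t^{\mathrm{HO}}_{z,b}$ with domain $\{f\in H^1(\mathbb R): xf(x)\in L^2(\mathbb R)\}$ and $$\mathfrak t^{\mathrm{HO}}_{z,b}(f,g)=(f',g')_{L^2(\mathbb R)}+(xf,xg)_{L^2(\mathbb R)}+z\left(f(b)\overline{g(b)}-f(-b)\overline{g(-b)}\right).$$ That is, $f$ is in the domain of $L_{\mathrm{HO}}(z,b)$ with $L_{\mathrm{HO}}(z,b)f=h\in L^2(\mathbb R)$ if and only if $f$ is in the form domain and $\mathfrak t^{\mathrm{HO}}_{z,b}(f,g)=(h,g)_{L^2(\mathbb R)}$ for all $g$ in the form domain. The operator has compact resolvent, so its spectrum $\operatorname{Sp}$ consists of eigenvalues. $\#(A)$ denotes the cardinality of the set $A$. *)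

theory Defs
  imports "HOL-Analysis.Analysis" "HOL-Library.Extended_Nat"
begin

text \<open>The space $L^2(\mathbb R)$ of complex functions is handled through representatives:
  two elements of \<open>L2\<close> denote the same vector iff they agree almost everywhere.\<close>

definition L2 :: "(real \<Rightarrow> complex) set" where
  "L2 = {f \<in> borel_measurable lborel. integrable lborel (\<lambda>x. (cmod (f x))\<^sup>2)}"

definition L2_inner :: "(real \<Rightarrow> complex) \<Rightarrow> (real \<Rightarrow> complex) \<Rightarrow> complex" where
  "L2_inner f g = (LINT x|lborel. f x * cnj (g x))"

definition L2_norm :: "(real \<Rightarrow> complex) \<Rightarrow> real" where
  "L2_norm f = sqrt (LINT x|lborel. (cmod (f x))\<^sup>2)"

definition test_function :: "(real \<Rightarrow> real) \<Rightarrow> bool" where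
  "test_function \<phi> \<longleftrightarrow>
     (\<forall>n x. (deriv ^^ n) \<phi> differentiable at x) \<and> compact (closure {x. \<phi> x \<noteq> 0})"

text \<open>Real-valued test functions suffice, since both sides are linear in \<open>\<phi>\<close>.\<close>

definition is_weak_deriv :: "(real \<Rightarrow> complex) \<Rightarrow> (real \<Rightarrow> complex) \<Rightarrow> bool" where
  "is_weak_deriv f u \<longleftrightarrow>
     (\<forall>\<phi>. test_function \<phi> \<longrightarrow>
        (LINT x|lborel. f x * of_real (deriv \<phi> x)) = - (LINT x|lborel. u x * of_real (\<phi> x)))"

text \<open>Every class in $H^1(\mathbb R)$ has exactly one continuous representative, and point values
  of $H^1$ functions refer to it; \<open>H1\<close> consists of these representatives.\<close>

definition H1 :: "(real \<Rightarrow> complex) set" where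
  "H1 = {f \<in> L2. continuous_on UNIV f \<and> (\<exists>u\<in>L2. is_weak_deriv f u)}"

text \<open>Determined up to a null set for \<open>f \<in> H1\<close>.\<close>

definition weak_deriv :: "(real \<Rightarrow> complex) \<Rightarrow> (real \<Rightarrow> complex)" where
  "weak_deriv f = (SOME u. u \<in> L2 \<and> is_weak_deriv f u)"

definition form_dom_HO :: "(real \<Rightarrow> complex) set" where
  "form_dom_HO = {f \<in> H1. (\<lambda>x. of_real x * f x) \<in> L2}"

definition form_HO ::
    "complex \<Rightarrow> real \<Rightarrow> (real \<Rightarrow> complex) \<Rightarrow> (real \<Rightarrow> complex) \<Rightarrow> complex" where
  "form_HO z b f g =
     L2_inner (weak_deriv f) (weak_deriv g)
     + L2_inner (\<lambda>x. of_real x * f x) (\<lambda>x. of_real x * g x)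
     + z * (f b * cnj (g b) - f (- b) * cnj (g (- b)))"

text \<open>Operators in $L^2(\mathbb R)$ are given by their graphs: \<open>L_HO z b f h\<close> states that
  \<open>f\<close> (its continuous representative) lies in the domain and is mapped to the class of \<open>h\<close>.\<close>

definition L_HO :: "complex \<Rightarrow> real \<Rightarrow> (real \<Rightarrow> complex) \<Rightarrow> (real \<Rightarrow> complex) \<Rightarrow> bool" where
  "L_HO z b f h \<longleftrightarrow>
     f \<in> form_dom_HO \<and> h \<in> L2 \<and> (\<forall>g\<in>form_dom_HO. form_HO z b f g = L2_inner h g)"

text \<open>\<open>T f (\<lambda>x. h x + \<mu> * f x)\<close> expresses $(T-\mu)f=h$. The three conditions say that
  $T-\mu$ is onto $L^2(\mathbb R)$, is injective up to null sets, and has bounded inverse.\<close>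

definition resolvent_set ::
    "((real \<Rightarrow> complex) \<Rightarrow> (real \<Rightarrow> complex) \<Rightarrow> bool) \<Rightarrow> complex set" where
  "resolvent_set T = {\<mu>.
     (\<forall>h\<in>L2. \<exists>f. T f (\<lambda>x. h x + \<mu> * f x)) \<and>
     (\<forall>h\<in>L2. \<forall>f g. T f (\<lambda>x. h x + \<mu> * f x) \<longrightarrow> T g (\<lambda>x. h x + \<mu> * g x) \<longrightarrow>
        (AE x in lborel. f x = g x)) \<and>
     (\<exists>C. \<forall>h\<in>L2. \<forall>f. T f (\<lambda>x. h x + \<mu> * f x) \<longrightarrow> L2_norm f \<le> C * L2_norm h)}"

definition Sp :: "((real \<Rightarrow> complex) \<Rightarrow> (real \<Rightarrow> complex) \<Rightarrow> bool) \<Rightarrow> complex set" where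
  "Sp T = - resolvent_set T"

text \<open>Unlike \<open>card\<close>, infinite sets have cardinality \<open>\<infinity>\<close>, not \<open>0\<close>.\<close>

definition ecard :: "'a set \<Rightarrow> enat" where
  "ecard A = (if finite A then enat (card A) else \<infinity>)"

definition N_HO :: "real \<Rightarrow> real \<Rightarrow> enat" where
  "N_HO b r = ecard (Sp (L_HO (\<i> * of_real r) b) - \<real>)"

end

theory Submission
  imports Defs "HOL-Complex_Analysis.Complex_Analysis" "HOL-Real_Asymp.Real_Asymp"
begin

text \<open>Let $\psi(x)$ be the solution of $-\psi''+x^2\psi=\lambda\psi$ that decays at $+\infty$, let $w$ be the
  Wronskian of $\psi(x)$ and $\psi(-x)$, and write $\lambda=1-2s$. If $w\neq 0$, then $\lambda$ is an
  eigenvalue for the coupling $ir$ as soon as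
  $w^2+r^2\,\psi(b)^2\,(\psi(-b)^2-\psi(b)^2)=0$, whose left hand side is entire in $s$. Let $s_0$ be a
  real non-integer zero of $s\mapsto\psi(b)$. There $w\neq 0$, so $\psi(-b)\neq 0$. For large $r$ the
  equation has a root near $s_0$ by the minimum modulus principle, and that root is not real: near
  $s_0$ the left hand side is positive at real $s$. So every such $s_0$ yields a non-real eigenvalue
  close to $1-2s_0$ for large $r$. Finally there are infinitely many such $s_0$, because the three-term
  recurrence for $\psi(b)$ in $s$ forces infinitely many strict sign changes along the non-positive
  integers.\<close>

section \<open>Smooth step functions\<close>

text \<open>Only a lower bound for the count is needed, so one inclusion suffices: explicit
  eigenfunctions put 1 - 2s into the spectrum, and neither the resolvent nor its compactness has to
  be studied. The main obstacle is the definition of the operator by its form. An eigenfunction has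
  to satisfy the form identity against every g of the form domain, and the derivative of g is just
  some L^2 function picked by \<open>SOME\<close>. So weak derivatives must be shown unique up to
  null sets, and g must be recovered as the integral of its weak derivative. Both rest on a supply
  of smooth compactly supported test functions, which are constructed from exp(-1/x). The real part
  of s also does the bookkeeping: the zeros of psi(b) are located in different intervals (-n-1, -n),
  which keeps them off the integers and keeps the resulting eigenvalues apart. Off the integers w is
  nonzero because it can be evaluated at x = 0, where the three-term recurrence loses its middle
  term.\<close>

definition flat :: "real poly \<Rightarrow> real \<Rightarrow> real" where
  "flat p x = (if x > 0 then poly p (1 / x) * exp (- 1 / x) else 0)"

text \<open>The point of this class is that it is closed under \<open>deriv\<close>, so the
  condition on all iterated derivatives in \<open>test_function\<close> becomes an induction. The
  affine argument in the generators allows reflection and rescaling.\<close>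

inductive_set smooth_alg :: "(real \<Rightarrow> real) set" where
  base: "(\<lambda>x. flat p (a * x + b)) \<in> smooth_alg"
| add: "f \<in> smooth_alg \<Longrightarrow> g \<in> smooth_alg \<Longrightarrow> (\<lambda>x. f x + g x) \<in> smooth_alg"
| mult: "f \<in> smooth_alg \<Longrightarrow> g \<in> smooth_alg \<Longrightarrow> (\<lambda>x. f x * g x) \<in> smooth_alg"

lemma poly_exp_at_top: "((\<lambda>y::real. poly p y * exp (- y)) \<longlongrightarrow> 0) at_top"
proof -
  have "((\<lambda>y::real. \<Sum>i\<le>degree p. coeff p i * (y ^ i / exp y)) \<longlongrightarrow> (\<Sum>i\<le>degree p. coeff p i * 0)) at_top"
    by (intro tendsto_intros tendsto_power_div_exp_0)
  moreover have "(\<lambda>y::real. \<Sum>i\<le>degree p. coeff p i * (y ^ i / exp y)) = (\<lambda>y. poly p y * exp (- y))"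
    by (simp add: poly_altdef sum_distrib_right exp_minus divide_inverse mult.assoc)
  ultimately show ?thesis by simp
qed

lemma poly_exp_inverse_at_right:
  "((\<lambda>x::real. poly p (1 / x) * exp (- 1 / x)) \<longlongrightarrow> 0) (at_right 0)"
proof -
  have "((\<lambda>x::real. poly p (inverse x) * exp (- inverse x)) \<longlongrightarrow> 0) (at_right 0)"
    by (rule filterlim_compose[OF poly_exp_at_top filterlim_inverse_at_top_right])
  then show ?thesis by (simp add: inverse_eq_divide)
qed

text \<open>For x > 0 a derivative of p(1/x) exp(-1/x) has the same shape with another polynomial,
  since 1/x has derivative -(1/x)^2; that is why a polynomial in 1/x is carried along. At 0 the
  exponential beats every power of 1/x.\<close>

lemma flat_has_derivative:
  "(flat p has_real_derivative flat ([:0, 0, 1:] * (p - pderiv p)) x) (at x)"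
proof (cases "x = 0")
  case True
  have "((\<lambda>h. flat p h / h) \<longlongrightarrow> 0) (at_left 0)"
    by (rule tendsto_eventually) (auto simp: flat_def eventually_at_filter)
  moreover have "((\<lambda>h. flat p h / h) \<longlongrightarrow> 0) (at_right 0)"
  proof (rule Lim_transform_eventually)
    \<comment> \<open>Dividing by x only multiplies the polynomial in 1/x by its variable.\<close>
    show "((\<lambda>x::real. poly ([:0,1:] * p) (1 / x) * exp (- 1 / x)) \<longlongrightarrow> 0) (at_right 0)"
      by (rule poly_exp_inverse_at_right)
    show "\<forall>\<^sub>F x in at_right 0. poly ([:0,1:] * p) (1 / x) * exp (- 1 / x) = flat p x / x"
      by (auto simp: flat_def eventually_at_filter field_simps)
  qed
  ultimately have "((\<lambda>h. flat p h / h) \<longlongrightarrow> 0) (at 0)"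
    by (simp add: filterlim_split_at)
  then show ?thesis
    using True by (simp add: has_field_derivative_iff flat_def)
next
  case False
  then consider "x < 0" | "x > 0" by linarith
  then show ?thesis
  proof cases
    case 1
    have "((\<lambda>x. 0) has_real_derivative 0) (at x)" by simp
    then have "(flat p has_real_derivative 0) (at x)"
      by (rule has_field_derivative_transform_within_open[where S = "{..<0}"])
        (use 1 in \<open>auto simp: flat_def\<close>)
    then show ?thesis using 1 by (simp add: flat_def)
  next
    case 2
    have "((\<lambda>x. poly p (1 / x) * exp (- 1 / x)) has_real_derivative
        flat ([:0, 0, 1:] * (p - pderiv p)) x) (at x)"
      using 2 by (auto intro!: derivative_eq_intros DERIV_chain2[OF poly_DERIV]
        simp: flat_def power2_eq_square algebra_simps)
    then show ?thesis
      by (rule has_field_derivative_transform_within_open[where S = "{0<..}"])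
        (use 2 in \<open>auto simp: flat_def\<close>)
  qed
qed

lemma smooth_alg_const_mult:
  assumes "f \<in> smooth_alg" shows "(\<lambda>x. c * f x) \<in> smooth_alg"
  using assms
proof (induction)
  case (base p a b)
  have "(\<lambda>x. c * flat p (a * x + b)) = (\<lambda>x. flat (smult c p) (a * x + b))"
    by (auto simp: flat_def)
  then show ?case using smooth_alg.base[of "smult c p" a b] by simp
next
  case (add f g)
  then show ?case using smooth_alg.add[OF add.IH] by (simp add: algebra_simps)
next
  case (mult f g)
  then show ?case using smooth_alg.mult[OF mult.IH(1) mult.hyps(2)] by (simp add: algebra_simps)
qed

lemma smooth_alg_affine:
  assumes "f \<in> smooth_alg" shows "(\<lambda>x. f (c * x + d)) \<in> smooth_alg"
  using assms
proof (induction)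
  case (base p a b)
  have "(\<lambda>x. flat p (a * (c * x + d) + b)) = (\<lambda>x. flat p ((a * c) * x + (a * d + b)))"
    by (simp add: algebra_simps)
  then show ?case using smooth_alg.base[of p "a * c" "a * d + b"] by simp
qed (auto intro: smooth_alg.intros)

lemma smooth_alg_derivative:
  assumes "f \<in> smooth_alg"
  shows "\<exists>f' \<in> smooth_alg. \<forall>x. (f has_real_derivative f' x) (at x)"
  using assms
proof (induction)
  case (base p a b)
  define q where "q = [:0, 0, 1:] * (p - pderiv p)"
  have "((\<lambda>x. flat p (a * x + b)) has_real_derivative flat q (a * x + b) * a) (at x)" for x
    unfolding q_def
    by (rule DERIV_chain2[OF flat_has_derivative]) (auto intro!: derivative_eq_intros)
  moreover have "(\<lambda>x. a * flat q (a * x + b)) \<in> smooth_alg"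
    by (intro smooth_alg_const_mult smooth_alg.base)
  ultimately show ?case by (intro bexI[of _ "\<lambda>x. a * flat q (a * x + b)"]) (auto simp: mult.commute)
next
  case (add f g)
  then obtain f' g' where "f' \<in> smooth_alg" "g' \<in> smooth_alg"
    "\<And>x. (f has_real_derivative f' x) (at x)" "\<And>x. (g has_real_derivative g' x) (at x)" by blast
  then show ?case
    by (intro bexI[of _ "\<lambda>x. f' x + g' x"] smooth_alg.intros) (auto intro!: derivative_eq_intros)
next
  case (mult f g)
  then obtain f' g' where "f' \<in> smooth_alg" "g' \<in> smooth_alg"
    "\<And>x. (f has_real_derivative f' x) (at x)" "\<And>x. (g has_real_derivative g' x) (at x)" by blast
  then show ?case using mult.hyps
    by (intro bexI[of _ "\<lambda>x. f' x * g x + f x * g' x"] smooth_alg.intros) (auto intro!: derivative_eq_intros)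
qed

lemma smooth_alg_deriv: "f \<in> smooth_alg \<Longrightarrow> deriv f \<in> smooth_alg"
proof -
  assume "f \<in> smooth_alg"
  then obtain f' where f': "f' \<in> smooth_alg" "\<And>x. (f has_real_derivative f' x) (at x)"
    using smooth_alg_derivative by blast
  then have "deriv f = f'" by (auto intro!: DERIV_imp_deriv)
  with f' show ?thesis by simp
qed

lemma smooth_alg_smooth:
  assumes "f \<in> smooth_alg" shows "(deriv ^^ n) f differentiable at x"
proof -
  have "(deriv ^^ n) f \<in> smooth_alg" using assms by (induction n) (auto intro: smooth_alg_deriv)
  then show ?thesis using smooth_alg_derivative real_differentiable_def by blast
qed

text \<open>The step function below arises as an antiderivative of a member of
  \<open>smooth_alg\<close>; from its first derivative on, everything stays in that class.\<close>

lemma antiderivative_smooth: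
  assumes "f \<in> smooth_alg" "\<And>x. (F has_real_derivative f x) (at x)"
  shows "(deriv ^^ n) F differentiable at x"
proof (cases n)
  case 0
  then show ?thesis using assms(2) real_differentiable_def by auto
next
  case (Suc m)
  have "deriv F = f" using assms(2) by (auto intro!: DERIV_imp_deriv)
  then show ?thesis using smooth_alg_smooth[OF assms(1)] by (simp add: Suc funpow_Suc_right del: funpow.simps)
qed

text \<open>Integrate a bump supported in [-1, 1] and normalise its mass to 1: \<open>\<rho>\<close>
  is then a mollifier and \<open>\<sigma>\<close> a smoothed Heaviside function.\<close>

lemma smooth_step_exists:
  obtains \<sigma> \<rho> :: "real \<Rightarrow> real" where
    "\<rho> \<in> smooth_alg" "\<And>x. (\<sigma> has_real_derivative \<rho> x) (at x)"
    "\<And>x. \<rho> x \<ge> 0" "\<And>x. x \<le> -1 \<Longrightarrow> \<sigma> x = 0" "\<And>x. x \<ge> 1 \<Longrightarrow> \<sigma> x = 1"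
    "\<And>x. \<bar>x\<bar> \<ge> 1 \<Longrightarrow> \<rho> x = 0" "\<And>x. \<bar>\<sigma> x\<bar> \<le> 1"
proof -
  \<comment> \<open>This is exp(-1/(1 + x)) exp(-1/(1 - x)) on (-1, 1); outside, one of the two
    factors vanishes.\<close>
  define r where "r = (\<lambda>x. flat 1 (1 * x + 1) * flat 1 ((-1) * x + 1))"
  have r: "r \<in> smooth_alg" unfolding r_def by (intro smooth_alg.mult smooth_alg.base)
  have r0: "r x \<ge> 0" for x by (simp add: r_def flat_def)
  have rpos: "r x > 0" if "\<bar>x\<bar> < 1" for x using that by (simp add: r_def flat_def abs_if split: if_splits)
  have rz: "r x = 0" if "\<bar>x\<bar> \<ge> 1" for x using that by (simp add: r_def flat_def abs_if split: if_splits)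
  have "isCont r x" for x
    using smooth_alg_derivative[OF r] DERIV_isCont by blast
  then obtain F where F: "\<And>x. (F has_vector_derivative r x) (at x)"
    using einterval_antiderivative[of "-\<infinity>" "\<infinity>" r] by auto
  then have F': "(F has_real_derivative r x) (at x)" for x
    by (simp add: has_real_derivative_iff_has_vector_derivative)
  have lo: "F x = F (-1)" if x: "x \<le> -1" for x
  proof (cases "x = -1")
    case False
    then have "x < -1" using x by simp
    from MVT2[OF this F'] obtain z where "x < z" "z < -1" "F (-1) - F x = (-1 - x) * r z"
      by blast
    then show ?thesis using rz[of z] by auto
  qed simp
  have hi: "F x = F 1" if x: "x \<ge> 1" for x
  proof (cases "x = 1")
    case False
    then have "1 < x" using x by simp
    from MVT2[OF this F'] obtain z where "1 < z" "z < x" "F x - F 1 = (x - 1) * r z"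
      by blast
    then show ?thesis using rz[of z] by auto
  qed simp
  \<comment> \<open>The mean value theorem places z strictly inside (-1, 1), where the bump is
    positive, so the total mass is not 0.\<close>
  obtain z where "-1 < z" "z < 1" "F 1 - F (-1) = (1 - (-1)) * r z"
    using MVT2[OF _ F', of "-1" 1] by auto
  with rpos[of z] have pos: "F 1 - F (-1) > 0" by auto
  define c where "c = 1 / (F 1 - F (-1))"
  have mono: "F x \<le> F y" if "x \<le> y" for x y
    using DERIV_nonneg_imp_nondecreasing[OF that] F' r0 by blast
  have range: "F (-1) \<le> F x" "F x \<le> F 1" for x
    using mono[of x "-1"] mono[of "-1" x] mono[of x 1] mono[of 1 x] lo[of x] hi[of x] by linarith+
  show ?thesis
  proof (rule that[of "\<lambda>x. c * r x" "\<lambda>x. c * (F x - F (-1))"])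
    show "(\<lambda>x. c * r x) \<in> smooth_alg" by (intro smooth_alg_const_mult r)
    show "((\<lambda>x. c * (F x - F (- 1))) has_real_derivative c * r x) (at x)" for x
      using F'[of x] by (auto intro!: derivative_eq_intros)
    show "\<bar>c * (F x - F (- 1))\<bar> \<le> 1" for x
      using range[of x] pos by (simp add: c_def field_simps)
    show "c * (F x - F (- 1)) = 0" if "x \<le> -1" for x using lo[OF that] by simp
    show "c * (F x - F (- 1)) = 1" if "x \<ge> 1" for x using hi[OF that] pos by (simp add: c_def)
  qed (use pos r0 rz in \<open>auto simp: c_def\<close>)
qed

section \<open>Weak derivatives\<close>

lemma integrable_continuous_compact_support:
  fixes f :: "real \<Rightarrow> 'a::euclidean_space"
  assumes "continuous_on UNIV f" "\<And>x. x \<notin> {p..q} \<Longrightarrow> f x = 0"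
  shows "integrable lborel f"
proof -
  have "set_integrable lborel {p..q} f"
    by (rule borel_integrable_atLeastAtMost') (use assms(1) in \<open>auto intro: continuous_on_subset\<close>)
  moreover have "(\<lambda>x. indicator {p..q} x *\<^sub>R f x) = f"
    using assms(2) by (auto simp: indicator_def)
  ultimately show ?thesis by (simp add: set_integrable_def)
qed

lemma L2_set_integrable:
  assumes "u \<in> L2" shows "set_integrable lborel {a..c} u"
proof -
  have [measurable]: "u \<in> borel_measurable lborel" and int: "integrable lborel (\<lambda>x. (cmod (u x))\<^sup>2)"
    using assms by (auto simp: L2_def)
  \<comment> \<open>On a bounded interval 1 is integrable, and |u| \<le> 1 + |u|^2 follows from (|u|
    - 1/2)^2 \<ge> 0.\<close>
  have "set_integrable lborel {a..c} (\<lambda>x. 1 + (cmod (u x))\<^sup>2)"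
  proof (intro set_integral_add(1))
    show "set_integrable lborel {a..c} (\<lambda>x. 1::real)"
      by (intro borel_integrable_atLeastAtMost') auto
    show "set_integrable lborel {a..c} (\<lambda>x. (cmod (u x))\<^sup>2)"
      unfolding set_integrable_def by (intro integrable_mult_indicator int) auto
  qed
  then show ?thesis unfolding set_integrable_def
  proof (rule Bochner_Integration.integrable_bound)
    show "AE x in lborel. norm (indicat_real {a..c} x *\<^sub>R u x)
        \<le> norm (indicat_real {a..c} x *\<^sub>R (1 + (cmod (u x))\<^sup>2))"
    proof (intro AE_I2)
      fix x
      have "0 \<le> (cmod (u x) - 1 / 2)\<^sup>2" by simp
      then have "cmod (u x) \<le> 1 + (cmod (u x))\<^sup>2" by (simp add: power2_diff power_divide)
      then show "norm (indicat_real {a..c} x *\<^sub>R u x)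
        \<le> norm (indicat_real {a..c} x *\<^sub>R (1 + (cmod (u x))\<^sup>2))"
        by (auto simp: indicator_def)
    qed
  qed measurable
qed

text \<open>The test functions approximate the indicator function of $[a,c]$, so that their derivatives
  approximate the difference of the point masses at $a$ and $c$.\<close>

lemma weak_deriv_FTC:
  fixes g u :: "real \<Rightarrow> complex"
  assumes g: "continuous_on UNIV g" and u: "\<And>a c. set_integrable lborel {a..c} u"
    and weak: "is_weak_deriv g u" and ac: "a \<le> c"
  shows "g c - g a = (LINT x:{a..c}|lborel. u x)"
proof -
  obtain \<rho> \<sigma> :: "real \<Rightarrow> real" where rho: "\<rho> \<in> smooth_alg"
    and sig: "\<And>x. (\<sigma> has_real_derivative \<rho> x) (at x)"
    and rho0: "\<And>x. \<rho> x \<ge> 0" and lo: "\<And>x. x \<le> -1 \<Longrightarrow> \<sigma> x = 0"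
    and hi: "\<And>x. x \<ge> 1 \<Longrightarrow> \<sigma> x = 1" and supp: "\<And>x. \<bar>x\<bar> \<ge> 1 \<Longrightarrow> \<rho> x = 0"
    and bd: "\<And>x. \<bar>\<sigma> x\<bar> \<le> 1"
    by (rule smooth_step_exists) blast
  have cont_rho: "continuous_on UNIV \<rho>"
    using smooth_alg_derivative[OF rho] DERIV_isCont continuous_at_imp_continuous_on by blast
  have cont_sig: "continuous_on UNIV \<sigma>"
    using sig DERIV_isCont continuous_at_imp_continuous_on by blast
  have [measurable]: "\<sigma> \<in> borel_measurable borel" "\<rho> \<in> borel_measurable borel" "g \<in> borel_measurable borel"
    using cont_rho cont_sig g by (auto intro: borel_measurable_continuous_onI)
  have int_rho: "integrable lborel \<rho>"
    by (rule integrable_continuous_compact_support[of _ "-1" 1]) (auto intro: cont_rho supp)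
  have mass: "(LINT y|lborel. \<rho> y) = 1"
  proof -
    have "(\<rho> has_integral (LINT y|lborel. \<rho> y)) UNIV"
      by (rule has_integral_integral_lborel[OF int_rho])
    moreover have "(\<rho> has_integral 1) UNIV"
    proof (rule has_integral_on_superset)
      show "(\<rho> has_integral 1) {-1..1}"
        using fundamental_theorem_of_calculus[of "-1" 1 \<sigma> \<rho>] sig lo[of "-1"] hi[of 1]
        by (auto simp: has_real_derivative_iff_has_vector_derivative intro: has_vector_derivative_at_within)
    qed (auto intro: supp)
    ultimately show ?thesis by (rule has_integral_unique)
  qed
  \<comment> \<open>Widths of at most 1, so that all supports stay in the fixed interval
    [a - 1, c + 1].\<close>
  define e where "e = (\<lambda>n. 1 / (real n + 1))"
  have e: "e n > 0" "e n \<le> 1" for n by (auto simp: e_def field_simps)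
  have e_lim: "e \<longlonglongrightarrow> 0"
    using LIMSEQ_inverse_real_of_nat by (simp add: e_def inverse_eq_divide add.commute)
  define \<phi> where "\<phi> = (\<lambda>n x. \<sigma> ((x - a) / e n) - \<sigma> ((x - c) / e n))"
  define \<phi>' where "\<phi>' = (\<lambda>n x. (\<rho> ((x - a) / e n) - \<rho> ((x - c) / e n)) / e n)"
  have der: "(\<phi> n has_real_derivative \<phi>' n x) (at x)" for n x
    unfolding \<phi>_def \<phi>'_def using e(1)[of n]
    by (auto intro!: derivative_eq_intros DERIV_chain2[OF sig] simp: field_simps)
  have smooth': "\<phi>' n \<in> smooth_alg" for n
  proof -
    have "(\<lambda>x. (1 / e n) * \<rho> ((1 / e n) * x + (- a / e n)) + (- 1 / e n) * \<rho> ((1 / e n) * x + (- c / e n)))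
        \<in> smooth_alg"
      by (intro smooth_alg.add smooth_alg_const_mult smooth_alg_affine rho)
    moreover have "\<phi>' n = (\<lambda>x. (1 / e n) * \<rho> ((1 / e n) * x + (- a / e n)) + (- 1 / e n) * \<rho> ((1 / e n) * x + (- c / e n)))"
      by (auto simp: \<phi>'_def diff_divide_distrib)
    ultimately show ?thesis by simp
  qed
  have phi0: "\<phi> n x = 0" if "x \<notin> {a - 1..c + 1}" for n x
  proof (cases "x < a - 1")
    case True
    then have "(x - a) / e n \<le> -1" "(x - c) / e n \<le> -1" using e[of n] ac by (auto simp: field_simps)
    then show ?thesis by (simp add: \<phi>_def lo)
  next
    case False
    then have "x > c + 1" using that by auto
    then have "(x - a) / e n \<ge> 1" "(x - c) / e n \<ge> 1" using e[of n] ac by (auto simp: field_simps)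
    then show ?thesis by (simp add: \<phi>_def hi)
  qed
  have test: "test_function (\<phi> n)" for n
    unfolding test_function_def
  proof (intro conjI allI)
    show "(deriv ^^ m) (\<phi> n) differentiable at x" for m x
      by (rule antiderivative_smooth[OF smooth' der])
    have "{x. \<phi> n x \<noteq> 0} \<subseteq> {a-1..c+1}" using phi0 by blast
    then show "compact (closure {x. \<phi> n x \<noteq> 0})"
      using bounded_closed_interval bounded_subset compact_closure by blast
  qed
  have deriv_phi: "deriv (\<phi> n) x = \<phi>' n x" for n x
    using der by (rule DERIV_imp_deriv)
  have eq: "(LINT x|lborel. g x * of_real (\<phi>' n x)) = - (LINT x|lborel. u x * of_real (\<phi> n x))" for n
    using weak test[of n] unfolding is_weak_deriv_def deriv_phi[symmetric] by blast
  \<comment> \<open>After the substitution x = p + e y the weight \<open>\<rho>\<close> no longer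
    depends on n and g is evaluated ever closer to p, so continuity of g yields g(p).\<close>
  have avg: "(\<lambda>n. LINT x|lborel. g x * of_real (\<rho> ((x - p) / e n) / e n)) \<longlonglongrightarrow> g p" for p
  proof -
    have eqn: "(LINT x|lborel. g x * of_real (\<rho> ((x - p) / e n) / e n))
        = (LINT y|lborel. g (p + e n * y) * of_real (\<rho> y))" for n
    proof -
      have "(LINT x|lborel. g x * of_real (\<rho> ((x - p) / e n) / e n)) =
        \<bar>e n\<bar> *\<^sub>R (LINT y|lborel. g (p + e n * y) * of_real (\<rho> ((p + e n * y - p) / e n) / e n))"
        by (rule lborel_integral_real_affine) (use e[of n] in auto)
      also have "\<dots> = (LINT y|lborel. \<bar>e n\<bar> *\<^sub>R (g (p + e n * y) * of_real (\<rho> ((p + e n * y - p) / e n) / e n)))"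
        by simp
      also have "\<dots> = (LINT y|lborel. g (p + e n * y) * of_real (\<rho> y))"
        using e(1)[of n] by (intro Bochner_Integration.integral_cong) (auto simp: scaleR_conv_of_real)
      finally show ?thesis .
    qed
    have lim: "(\<lambda>n. LINT y|lborel. g (p + e n * y) * of_real (\<rho> y)) \<longlonglongrightarrow> (LINT y|lborel. g p * of_real (\<rho> y))"
    proof -
      obtain M where M: "\<And>x. x \<in> {p-1..p+1} \<Longrightarrow> norm (g x) \<le> M"
      proof -
        have "bounded (g ` {p-1..p+1})"
          by (intro compact_imp_bounded compact_continuous_image continuous_on_subset[OF g]) auto
        then show ?thesis using that unfolding bounded_iff by blast
      qed
      show ?thesis
      proof (rule integral_dominated_convergence)
        show "integrable lborel (\<lambda>y. M * \<rho> y)" using int_rho by simp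
        show "AE y in lborel. (\<lambda>n. g (p + e n * y) * of_real (\<rho> y)) \<longlonglongrightarrow> g p * of_real (\<rho> y)"
        proof (intro AE_I2 tendsto_mult tendsto_const)
          fix y
          have "(\<lambda>n. p + e n * y) \<longlonglongrightarrow> p + 0 * y" by (intro tendsto_intros e_lim)
          then show "(\<lambda>n. g (p + e n * y)) \<longlonglongrightarrow> g p"
            using continuous_on_tendsto_compose[OF g] by simp
        qed
        show "AE y in lborel. norm (g (p + e n * y) * of_real (\<rho> y)) \<le> M * \<rho> y" for n
        proof (intro AE_I2)
          fix y
          show "norm (g (p + e n * y) * of_real (\<rho> y)) \<le> M * \<rho> y"
          proof (cases "\<bar>y\<bar> \<ge> 1")
            case False
            then have "\<bar>e n * y\<bar> \<le> 1 * 1" unfolding abs_mult using e[of n] by (intro mult_mono) auto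
            then have "norm (g (p + e n * y)) \<le> M" by (intro M) auto
            then show ?thesis using rho0[of y] by (simp add: norm_mult mult_right_mono)
          qed (simp add: supp)
        qed
      qed measurable
    qed
    have "(LINT y|lborel. g p * of_real (\<rho> y)) = g p"
      using int_rho mass by simp
    then show ?thesis using lim unfolding eqn by (simp add: mass)
  qed
  have avg_int: "integrable lborel (\<lambda>x. g x * of_real (\<rho> ((x - p) / e n) / e n))" for p n
  proof (rule integrable_continuous_compact_support)
    show "continuous_on UNIV (\<lambda>x. g x * of_real (\<rho> ((x - p) / e n) / e n))"
      using e(1)[of n] by (intro continuous_intros g continuous_on_compose2[OF cont_rho]) auto
    fix x assume "x \<notin> {p-1..p+1}"
    then have "\<bar>x - p\<bar> \<ge> e n" using e(2)[of n] by auto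
    then have "\<bar>(x - p) / e n\<bar> \<ge> 1" using e(1)[of n] by (auto simp: field_simps)
    then show "g x * of_real (\<rho> ((x - p) / e n) / e n) = 0" using supp by simp
  qed
  have "(LINT x|lborel. g x * of_real (\<phi>' n x)) = (LINT x|lborel. g x * of_real (\<rho> ((x - a) / e n) / e n))
      - (LINT x|lborel. g x * of_real (\<rho> ((x - c) / e n) / e n))" for n
    unfolding Bochner_Integration.integral_diff[OF avg_int avg_int, symmetric]
    by (intro Bochner_Integration.integral_cong) (simp_all add: \<phi>'_def diff_divide_distrib right_diff_distrib)
  then have "(\<lambda>n. LINT x|lborel. g x * of_real (\<phi>' n x)) \<longlonglongrightarrow> g a - g c"
    using tendsto_diff[OF avg[of a] avg[of c]] by simp
  moreover have "(\<lambda>n. LINT x|lborel. u x * of_real (\<phi> n x)) \<longlonglongrightarrow> (LINT x|lborel. indicator {a..c} x *\<^sub>R u x)"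
  proof (rule integral_dominated_convergence)
    let ?w = "\<lambda>x. 2 * norm (indicator {a-1..c+1} x *\<^sub>R u x)"
    show "integrable lborel ?w"
      using u[of "a-1" "c+1", unfolded set_integrable_def]
      by (intro integrable_mult_right integrable_norm)
    \<comment> \<open>At x = p the rescaled step has the constant value \<open>\<sigma> 0\<close>,
      which need not match the indicator, so the two jump points are discarded as a null
      set.\<close>
    have "{a, c} \<in> null_sets lborel" by (simp add: finite_imp_null_set_lborel)
    then show "AE x in lborel. (\<lambda>n. u x * of_real (\<phi> n x)) \<longlonglongrightarrow> indicator {a..c} x *\<^sub>R u x"
    proof (rule AE_I')
      have key: "(\<lambda>n. \<sigma> ((x - p) / e n)) \<longlonglongrightarrow> indicator {p..} x" if "x \<noteq> p" for x p
      proof -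
        have "\<forall>\<^sub>F n in sequentially. e n < \<bar>x - p\<bar>"
          using e_lim that by (auto intro: order_tendstoD)
        then have "\<forall>\<^sub>F n in sequentially. \<sigma> ((x - p) / e n) = indicator {p..} x"
        proof eventually_elim
          case (elim n)
          show ?case
          proof (cases "x > p")
            case True
            then have "(x - p) / e n \<ge> 1" using elim e(1)[of n] by (auto simp: field_simps)
            then show ?thesis using True hi by simp
          next
            case False
            then have "(x - p) / e n \<le> -1" using elim e(1)[of n] by (auto simp: field_simps)
            then show ?thesis using False lo that by simp
          qed
        qed
        then show ?thesis by (rule tendsto_eventually)
      qed
      have "(\<lambda>n. u x * of_real (\<phi> n x)) \<longlonglongrightarrow> indicator {a..c} x *\<^sub>R u x" if "x \<noteq> a" "x \<noteq> c" for x
      proof -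
        have "(\<lambda>n. u x * of_real (\<phi> n x)) \<longlonglongrightarrow> u x * of_real (indicator {a..} x - indicator {c..} x)"
          unfolding \<phi>_def by (intro tendsto_intros key that)
        moreover have "u x * of_real (indicator {a..} x - indicator {c..} x) = indicator {a..c} x *\<^sub>R u x"
          using that ac by (auto simp: indicator_def)
        ultimately show ?thesis by simp
      qed
      then show "{x \<in> space lborel. \<not> (\<lambda>n. u x * of_real (\<phi> n x)) \<longlonglongrightarrow> indicator {a..c} x *\<^sub>R u x} \<subseteq> {a, c}"
        by auto
    qed
    show "AE x in lborel. norm (u x * of_real (\<phi> n x)) \<le> ?w x" for n
    proof (intro AE_I2)
      fix x
      have "\<bar>\<phi> n x\<bar> \<le> 2" using bd[of "(x - a) / e n"] bd[of "(x - c) / e n"] by (simp add: \<phi>_def)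
      then have "norm (u x) * \<bar>\<phi> n x\<bar> \<le> norm (u x) * 2" by (intro mult_left_mono) auto
      then show "norm (u x * of_real (\<phi> n x)) \<le> ?w x"
        using phi0[of x n] by (auto simp: norm_mult indicator_def)
    qed
    show "(\<lambda>x. indicator {a..c} x *\<^sub>R u x) \<in> borel_measurable lborel"
      using u[of a c] by (auto simp: set_integrable_def)
    show "(\<lambda>x. u x * of_real (\<phi> n x)) \<in> borel_measurable lborel" for n
    proof -
      \<comment> \<open>The hypothesis on u gives measurability only after cutting off to a bounded
        interval; the support of \<open>\<phi> n\<close> makes the cut-off harmless.\<close>
      have "(\<lambda>x. (indicator {a-1..c+1} x *\<^sub>R u x) * of_real (\<phi> n x)) \<in> borel_measurable lborel"
        using u[of "a-1" "c+1", unfolded set_integrable_def, THEN borel_measurable_integrable]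
        unfolding \<phi>_def by measurable
      moreover have "(\<lambda>x. (indicator {a-1..c+1} x *\<^sub>R u x) * of_real (\<phi> n x)) = (\<lambda>x. u x * of_real (\<phi> n x))"
        using phi0[of _ n] by (auto simp: indicator_def)
      ultimately show ?thesis by simp
    qed
  qed
  then have "(\<lambda>n. - (LINT x|lborel. u x * of_real (\<phi> n x))) \<longlonglongrightarrow> - (LINT x:{a..c}|lborel. u x)"
    by (auto simp: set_lebesgue_integral_def intro: tendsto_minus)
  ultimately have "g a - g c = - (LINT x:{a..c}|lborel. u x)"
    unfolding eq by (rule LIMSEQ_unique)
  then show ?thesis by (simp add: algebra_simps)
qed

text \<open>Closed intervals form an intersection-stable generator of the Borel sets, so vanishing
  integrals spread to all Borel sets by a Dynkin argument. Truncating to [-n, n] makes d integrable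
  on the line, as complements and disjoint unions require.\<close>

lemma AE_zero_if_interval_integrals_zero:
  fixes d :: "real \<Rightarrow> real"
  assumes int: "\<And>a c. set_integrable lborel {a..c} d"
    and zero: "\<And>a c. (LINT x:{a..c}|lborel. d x) = 0"
  shows "AE x in lborel. d x = 0"
proof -
  have *: "AE x in lborel. indicator {-real n..real n} x *\<^sub>R d x = 0" for n
  proof (rule density_unique_real)
    let ?d = "\<lambda>x. indicator {-real n..real n} x *\<^sub>R d x"
    show i: "integrable lborel ?d" using int by (simp add: set_integrable_def)
    fix A :: "real set" assume "A \<in> sets lborel"
    then have A: "A \<in> sigma_sets UNIV (range (\<lambda>(a, b). {a..b::real}))"
      by (simp add: borel_eq_atLeastAtMost)
    have "Int_stable (range (\<lambda>(a, b). {a..b::real}))"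
      by (auto simp: Int_stable_def)
    moreover have "range (\<lambda>(a, b). {a..b::real}) \<subseteq> Pow UNIV" by simp
    ultimately have "(LINT x:A|lborel. ?d x) = 0"
      using A
    proof (induction rule: sigma_sets_induct_disjoint)
      case (basic A)
      then obtain a b where A: "A = {a..b}" by auto
      \<comment> \<open>The truncation merely shortens the interval, possibly to the empty
        one.\<close>
      have "(LINT x:A|lborel. ?d x) = (LINT x:{max a (- real n)..min b (real n)}|lborel. d x)"
        unfolding set_lebesgue_integral_def
        by (intro Bochner_Integration.integral_cong) (auto simp: A indicator_def)
      then show ?case using zero by simp
    next
      case (compl A)
      then have [measurable]: "A \<in> sets borel" by (simp add: borel_eq_atLeastAtMost)
      have "(LINT x:UNIV - A|lborel. ?d x) = (LINT x|lborel. ?d x - indicator A x *\<^sub>R ?d x)"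
        unfolding set_lebesgue_integral_def
        by (intro Bochner_Integration.integral_cong) (auto simp: indicator_def)
      also have "\<dots> = (LINT x|lborel. ?d x) - (LINT x|lborel. indicator A x *\<^sub>R ?d x)"
        by (intro Bochner_Integration.integral_diff i integrable_mult_indicator) auto
      also have "\<dots> = 0" using zero[of "-real n" "real n"] compl by (simp add: set_lebesgue_integral_def)
      finally show ?case .
    next
      case (union A)
      then have A: "A i \<in> sets borel" for i by (auto simp: borel_eq_atLeastAtMost)
      then have "set_integrable lborel (\<Union>i. A i) ?d"
        unfolding set_integrable_def by (intro integrable_mult_indicator[OF _ i]) auto
      with A have "(LINT x:(\<Union>i. A i)|lborel. ?d x) = (\<Sum>i. LINT x:A i|lborel. ?d x)"
        using union.hyps by (intro lebesgue_integral_countable_add) (auto simp: disjoint_family_on_def)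
      then show ?case using union by simp
    qed (simp add: set_lebesgue_integral_def)
    then show "(LINT x:A|lborel. ?d x) = (LINT x:A|lborel. 0)" by (simp add: set_lebesgue_integral_def)
  qed simp
  have "AE x in lborel. \<forall>n. indicator {-real n..real n} x *\<^sub>R d x = 0"
    unfolding AE_all_countable using * by blast
  then show ?thesis
  proof eventually_elim
    case (elim x)
    obtain n where "real n \<ge> \<bar>x\<bar>" using real_arch_simple by blast
    then show ?case using elim[rule_format, of n] by (auto simp: indicator_def split: if_splits)
  qed
qed

text \<open>\<open>weak_deriv\<close> is an unspecified choice, so evaluating the form requires
  identifying it with an explicit derivative. Two candidates have equal integrals over every
  interval, namely the increments of f.\<close>

lemma weak_deriv_unique:
  assumes "continuous_on UNIV f" "u \<in> L2" "v \<in> L2" "is_weak_deriv f u" "is_weak_deriv f v"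
  shows "AE x in lborel. u x = v x"
proof -
  have uv: "set_integrable lborel {a..c} u" "set_integrable lborel {a..c} v" for a c
    using assms L2_set_integrable by auto
  have d: "set_integrable lborel {a..c} (\<lambda>x. u x - v x)" for a c
    using uv by (rule set_integral_diff)
  have z: "(LINT x:{a..c}|lborel. u x - v x) = 0" for a c
  proof (cases "a \<le> c")
    case True
    have "(LINT x:{a..c}|lborel. u x - v x) = (LINT x:{a..c}|lborel. u x) - (LINT x:{a..c}|lborel. v x)"
      using uv by (rule set_integral_diff)
    also have "\<dots> = 0"
      using weak_deriv_FTC[OF assms(1) uv(1) assms(4) True] weak_deriv_FTC[OF assms(1) uv(2) assms(5) True] by simp
    finally show ?thesis .
  qed (simp add: set_lebesgue_integral_def)
  have "AE x in lborel. Re (u x - v x) = 0"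
  proof (rule AE_zero_if_interval_integrals_zero)
    show "set_integrable lborel {a..c} (\<lambda>x. Re (u x - v x))" for a c
      using integrable_Re[OF d[of a c, unfolded set_integrable_def]] by (simp add: set_integrable_def)
    show "(LINT x:{a..c}|lborel. Re (u x - v x)) = 0" for a c
      using integral_Re[OF d[of a c, unfolded set_integrable_def]] z[of a c]
      by (simp add: set_lebesgue_integral_def)
  qed
  moreover have "AE x in lborel. Im (u x - v x) = 0"
  proof (rule AE_zero_if_interval_integrals_zero)
    show "set_integrable lborel {a..c} (\<lambda>x. Im (u x - v x))" for a c
      using integrable_Im[OF d[of a c, unfolded set_integrable_def]] by (simp add: set_integrable_def)
    show "(LINT x:{a..c}|lborel. Im (u x - v x)) = 0" for a c
      using integral_Im[OF d[of a c, unfolded set_integrable_def]] z[of a c]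
      by (simp add: set_lebesgue_integral_def)
  qed
  ultimately show ?thesis by eventually_elim (simp add: complex_eq_iff)
qed

section \<open>Integrability criteria and integration by parts on bounded intervals\<close>

lemma has_vector_derivative_imp_continuous_on_UNIV:
  assumes "\<And>x. (f has_vector_derivative f' x) (at x)"
  shows "continuous_on UNIV f"
  by (intro continuous_at_imp_continuous_on ballI) (rule has_vector_derivative_continuous[OF assms])

lemma integrable_inverse_1_plus_square: "integrable lborel (\<lambda>x::real. inverse (1 + x\<^sup>2))"
proof -
  have "set_integrable lborel (einterval (-\<infinity>) \<infinity>) (\<lambda>x. inverse (1 + x\<^sup>2) :: real)"
  proof (rule interval_integral_FTC_nonneg(1))
    show "DERIV arctan x :> inverse (1 + x\<^sup>2)" for x by (rule DERIV_arctan)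
    show "isCont (\<lambda>x. inverse (1 + x\<^sup>2)) x" for x :: real
      by (intro continuous_intros) (auto simp: add_nonneg_eq_0_iff)
    show "((arctan \<circ> real_of_ereal) \<longlongrightarrow> - pi / 2) (at_right (- \<infinity>))"
      by (simp add: ereal_tendsto_simps tendsto_arctan_at_bot)
    show "((arctan \<circ> real_of_ereal) \<longlongrightarrow> pi / 2) (at_left \<infinity>)"
      by (simp add: ereal_tendsto_simps tendsto_arctan_at_top)
  qed auto
  then show ?thesis by (simp add: set_integrable_def)
qed

lemma L2_I:
  fixes f :: "real \<Rightarrow> complex"
  assumes f: "f \<in> borel_measurable borel" and bd: "\<And>x. norm (f x) * (1 + x\<^sup>2) \<le> C"
  shows "f \<in> L2"
proof -
  have [measurable]: "f \<in> borel_measurable lborel" using f by simp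
  have "integrable lborel (\<lambda>x. C\<^sup>2 * inverse (1 + x\<^sup>2))"
    by (intro integrable_mult_right integrable_inverse_1_plus_square)
  then have "integrable lborel (\<lambda>x. (cmod (f x))\<^sup>2)"
  proof (rule Bochner_Integration.integrable_bound)
    show "AE x in lborel. norm ((cmod (f x))\<^sup>2) \<le> norm (C\<^sup>2 * inverse (1 + x\<^sup>2))"
    proof (intro AE_I2)
      fix x :: real
      have *: "(1::real) \<le> 1 + x\<^sup>2" by simp
      have "(cmod (f x))\<^sup>2 * (1 + x\<^sup>2) \<le> (cmod (f x))\<^sup>2 * (1 + x\<^sup>2)\<^sup>2"
        using self_le_power[OF *, of 2] by (intro mult_left_mono) auto
      also have "\<dots> = (norm (f x) * (1 + x\<^sup>2))\<^sup>2" by (simp add: power_mult_distrib)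
      also have "\<dots> \<le> C\<^sup>2" using bd[of x] by (intro power_mono) auto
      finally have "(cmod (f x))\<^sup>2 \<le> C\<^sup>2 / (1 + x\<^sup>2)"
        using * by (subst pos_le_divide_eq) linarith+
      then show "norm ((cmod (f x))\<^sup>2) \<le> norm (C\<^sup>2 * inverse (1 + x\<^sup>2))"
        by (simp add: divide_inverse)
    qed
  qed measurable
  then show ?thesis using f by (simp add: L2_def)
qed

lemma L2_mult_cnj_integrable:
  assumes "f \<in> L2" "g \<in> L2" shows "integrable lborel (\<lambda>x. f x * cnj (g x))"
proof -
  have [measurable]: "f \<in> borel_measurable lborel" "g \<in> borel_measurable lborel"
    and int: "integrable lborel (\<lambda>x. (cmod (f x))\<^sup>2)" "integrable lborel (\<lambda>x. (cmod (g x))\<^sup>2)"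
    using assms by (auto simp: L2_def)
  have [measurable]: "(\<lambda>x. cnj (g x)) \<in> borel_measurable lborel"
    by (rule measurable_compose[OF _ borel_measurable_continuous_onI]) (auto intro: continuous_intros)
  have "integrable lborel (\<lambda>x. (cmod (f x))\<^sup>2 + (cmod (g x))\<^sup>2)" using int by simp
  then show ?thesis
  proof (rule Bochner_Integration.integrable_bound)
    show "AE x in lborel. norm (f x * cnj (g x)) \<le> norm ((cmod (f x))\<^sup>2 + (cmod (g x))\<^sup>2)"
    proof (intro AE_I2)
      fix x
      have "0 \<le> cmod (f x) * cmod (g x)" by simp
      then have "cmod (f x) * cmod (g x) \<le> (cmod (f x))\<^sup>2 + (cmod (g x))\<^sup>2"
        using sum_squares_bound[of "cmod (f x)" "cmod (g x)"] by linarith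
      then show "norm (f x * cnj (g x)) \<le> norm ((cmod (f x))\<^sup>2 + (cmod (g x))\<^sup>2)"
        by (simp add: norm_mult)
    qed
  qed measurable
qed

lemma set_integrable_mult_continuous:
  fixes F u :: "real \<Rightarrow> complex"
  assumes "continuous_on UNIV F" "set_integrable lborel {a..c} u"
  shows "set_integrable lborel {a..c} (\<lambda>x. F x * u x)"
proof -
  have "bounded (F ` {a..c})"
    by (intro compact_imp_bounded compact_continuous_image continuous_on_subset[OF assms(1)]) auto
  then obtain M where M: "\<And>x. x \<in> {a..c} \<Longrightarrow> norm (F x) \<le> M" unfolding bounded_iff by blast
  have [measurable]: "F \<in> borel_measurable borel" using assms(1) by (rule borel_measurable_continuous_onI)
  have iu: "integrable lborel (\<lambda>x. indicator {a..c} x *\<^sub>R u x)"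
    using assms(2) by (simp add: set_integrable_def)
  then have "integrable lborel (\<lambda>x. M * norm (indicator {a..c} x *\<^sub>R u x))"
    by (intro integrable_mult_right integrable_norm)
  then have "integrable lborel (\<lambda>x. F x * (indicator {a..c} x *\<^sub>R u x))"
  proof (rule Bochner_Integration.integrable_bound)
    show "(\<lambda>x. F x * (indicator {a..c} x *\<^sub>R u x)) \<in> borel_measurable lborel"
      using borel_measurable_integrable[OF iu] by measurable
    show "AE x in lborel. norm (F x * (indicator {a..c} x *\<^sub>R u x)) \<le> norm (M * norm (indicator {a..c} x *\<^sub>R u x))"
    proof (intro AE_I2)
      fix x
      show "norm (F x * (indicator {a..c} x *\<^sub>R u x)) \<le> norm (M * norm (indicator {a..c} x *\<^sub>R u x))"
        using mult_right_mono[OF order_trans[OF M abs_ge_self], of x "norm (u x)"]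
        by (auto simp: norm_mult abs_mult indicator_def)
    qed
  qed
  then show ?thesis by (simp add: set_integrable_def mult_scaleR_right)
qed

lemma integration_by_parts_indefinite_integral:
  fixes F F' g u :: "real \<Rightarrow> complex"
  assumes F: "\<And>x. (F has_vector_derivative F' x) (at x)" and F': "continuous_on UNIV F'"
    and u: "set_integrable lborel {a..c} u" and g: "continuous_on UNIV g" and ac: "a \<le> c"
    and gu: "\<And>x. x \<in> {a..c} \<Longrightarrow> g x - g a = (LINT t:{a..x}|lborel. u t)"
  shows "((\<lambda>x. F x * u x + F' x * g x) has_integral F c * g c - F a * g a) {a..c}"
proof -
  have contF: "continuous_on UNIV F"
    using F by (rule has_vector_derivative_imp_continuous_on_UNIV)
  have [measurable]: "F \<in> borel_measurable borel" "F' \<in> borel_measurable borel" "g \<in> borel_measurable borel"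
    using contF F' g by (auto intro: borel_measurable_continuous_onI)
  \<comment> \<open>The cut-offs make F' and u integrable on the line, hence their product
    integrable on the plane, as Fubini requires.\<close>
  define A where "A = (\<lambda>x. indicator {a..c} x *\<^sub>R F' x)"
  define B where "B = (\<lambda>t. indicator {a..c} t *\<^sub>R u t)"
  have iB: "integrable lborel B" using u by (simp add: set_integrable_def B_def)
  have iA: "integrable lborel A"
    using borel_integrable_atLeastAtMost'[OF continuous_on_subset[OF F' subset_UNIV]]
    by (simp add: set_integrable_def A_def)
  note [measurable] = borel_measurable_integrable[OF iA] borel_measurable_integrable[OF iB]
  have iAB: "integrable (lborel \<Otimes>\<^sub>M lborel) (\<lambda>(x, t). A x * B t)"
  proof (rule lborel_pair.Fubini_integrable)
    show "integrable lborel (\<lambda>x. LINT t|lborel. norm (case (x, t) of (x, t) \<Rightarrow> A x * B t))"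
      using iA by (simp add: norm_mult integrable_mult_left integrable_norm)
    show "AE x in lborel. integrable lborel (\<lambda>t. case (x, t) of (x, t) \<Rightarrow> A x * B t)"
      using iB by simp
  qed measurable
  have iH: "integrable (lborel \<Otimes>\<^sub>M lborel) (\<lambda>(x, t). if t \<le> x then A x * B t else 0)"
    using iAB by (rule Bochner_Integration.integrable_bound) (measurable, auto)
  \<comment> \<open>With x inside, the inner integral runs from t to c and gives F(c) - F(t); with t
    inside, it runs from a to x and gives g(x) - g(a).\<close>
  have "(LINT t|lborel. LINT x|lborel. (if t \<le> x then A x * B t else 0))
      = (LINT x|lborel. LINT t|lborel. (if t \<le> x then A x * B t else 0))"
    by (rule lborel_pair.Fubini_integral[OF iH])
  moreover have "(LINT x|lborel. (if t \<le> x then A x * B t else 0)) = indicator {a..c} t *\<^sub>R (F c * u t - F t * u t)" for t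
  proof (cases "t \<in> {a..c}")
    case True
    have "(LINT x|lborel. (if t \<le> x then A x * B t else 0)) = (LINT x|lborel. indicator {t..c} x *\<^sub>R F' x * B t)"
      using True by (intro Bochner_Integration.integral_cong) (auto simp: A_def indicator_def)
    also have "\<dots> = (LINT x|lborel. indicator {t..c} x *\<^sub>R F' x) * B t"
      by (rule integral_mult_left_zero)
    also have "(LINT x|lborel. indicator {t..c} x *\<^sub>R F' x) = F c - F t"
      using True by (intro integral_FTC_atLeastAtMost)
        (auto intro: has_vector_derivative_at_within F continuous_on_subset[OF F'])
    finally show ?thesis using True by (simp add: B_def algebra_simps)
  next
    case False
    then have i: "indicator {a..c} t = (0::real)" by (rule indicator_simps(2))
    then have "(if t \<le> x then A x * B t else 0) = 0" for x by (simp add: B_def)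
    then show ?thesis by (simp only: i) simp
  qed
  moreover have "(LINT t|lborel. (if t \<le> x then A x * B t else 0)) = indicator {a..c} x *\<^sub>R (F' x * g x - F' x * g a)" for x
  proof (cases "x \<in> {a..c}")
    case True
    have "(LINT t|lborel. (if t \<le> x then A x * B t else 0)) = (LINT t|lborel. F' x * (indicator {a..x} t *\<^sub>R u t))"
      using True by (intro Bochner_Integration.integral_cong) (auto simp: A_def B_def indicator_def)
    also have "\<dots> = F' x * (LINT t|lborel. indicator {a..x} t *\<^sub>R u t)"
      by (rule integral_mult_right_zero)
    also have "\<dots> = F' x * (g x - g a)"
      unfolding gu[OF True] by (simp add: set_lebesgue_integral_def)
    finally show ?thesis using True by (simp add: algebra_simps)
  next
    case False
    then have i: "indicator {a..c} x = (0::real)" by (rule indicator_simps(2))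
    then have "(if t \<le> x then A x * B t else 0) = 0" for t by (simp add: A_def)
    then show ?thesis by (simp only: i) simp
  qed
  ultimately have swap: "(LINT x:{a..c}|lborel. F c * u x - F x * u x)
      = (LINT x:{a..c}|lborel. F' x * g x - F' x * g a)"
    by (simp add: set_lebesgue_integral_def)
  have iFu: "set_integrable lborel {a..c} (\<lambda>x. F x * u x)"
    using contF u by (rule set_integrable_mult_continuous)
  have icu: "set_integrable lborel {a..c} (\<lambda>x. F c * u x)"
    using u by (rule set_integrable_mult_right)
  have iFg: "set_integrable lborel {a..c} (\<lambda>x. F' x * g x)"
    by (rule borel_integrable_atLeastAtMost', rule continuous_on_subset[OF _ subset_UNIV])
      (intro continuous_intros F' g)
  have iFa: "set_integrable lborel {a..c} (\<lambda>x. F' x * g a)"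
    by (rule borel_integrable_atLeastAtMost', rule continuous_on_subset[OF _ subset_UNIV])
      (intro continuous_intros F')
  have "(LINT x|lborel. indicator {a..c} x *\<^sub>R F' x) = F c - F a"
    by (rule integral_FTC_atLeastAtMost[OF ac])
      (auto intro: has_vector_derivative_at_within F continuous_on_subset[OF F'])
  then have "(LINT x:{a..c}|lborel. F' x * g a) = (F c - F a) * g a"
    by (simp add: set_lebesgue_integral_def mult_scaleR_left[symmetric] del: mult_scaleR_left)
  moreover have "(LINT x:{a..c}|lborel. F c * u x) = F c * (g c - g a)"
    using gu[of c] ac by simp
  ultimately have "F c * (g c - g a) - (LINT x:{a..c}|lborel. F x * u x)
      = (LINT x:{a..c}|lborel. F' x * g x) - (F c - F a) * g a"
    using swap set_integral_diff(2)[OF icu iFu] set_integral_diff(2)[OF iFg iFa] by metis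
  then have eq: "(LINT x:{a..c}|lborel. F x * u x + F' x * g x) = F c * g c - F a * g a"
    unfolding set_integral_add(2)[OF iFu iFg] by (simp add: algebra_simps)
  have i: "set_integrable lborel {a..c} (\<lambda>x. F x * u x + F' x * g x)"
    by (rule set_integral_add(1)[OF iFu iFg])
  show ?thesis using set_borel_integral_eq_integral[OF i] eq
    by (metis has_integral_integral)
qed

section \<open>Piecewise smooth eigenfunctions\<close>

lemma form_dom_weak_deriv:
  assumes "g \<in> form_dom_HO"
  shows "g \<in> L2" "continuous_on UNIV g" "(\<lambda>x. of_real x * g x) \<in> L2"
    "weak_deriv g \<in> L2" "is_weak_deriv g (weak_deriv g)"
proof -
  have "\<exists>u. u \<in> L2 \<and> is_weak_deriv g u" using assms by (auto simp: form_dom_HO_def H1_def)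
  from someI_ex[OF this] show "weak_deriv g \<in> L2" "is_weak_deriv g (weak_deriv g)"
    by (auto simp: weak_deriv_def)
qed (use assms in \<open>auto simp: form_dom_HO_def H1_def\<close>)

text \<open>With v the weak derivative, |v| \<le> 1 + |v|^2 bounds the increment of g over [p, q] by
  q - p plus the integral of |v|^2. This crude growth is enough, because the boundary terms pair g
  with a function bounded by a multiple of 1/(1 + x^2).\<close>

lemma form_dom_linear_growth:
  assumes "g \<in> form_dom_HO"
  obtains A where "\<And>x. norm (g x) \<le> A + \<bar>x\<bar>"
proof -
  define v where "v = weak_deriv g"
  note g = form_dom_weak_deriv[OF assms, folded v_def]
  have iv: "set_integrable lborel {p..q} v" for p q by (rule L2_set_integrable[OF g(4)])
  have iv2: "integrable lborel (\<lambda>x. (cmod (v x))\<^sup>2)" using g(4) by (simp add: L2_def)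
  define V where "V = (LINT x|lborel. (cmod (v x))\<^sup>2)"
  have diff: "norm (g q - g p) \<le> (q - p) + V" if "p \<le> q" for p q
  proof -
    have "norm (g q - g p) = norm (LINT x:{p..q}|lborel. v x)"
      using weak_deriv_FTC[OF g(2) iv g(5) that] by simp
    also have "\<dots> \<le> (LINT x|lborel. norm (indicator {p..q} x *\<^sub>R v x))"
      unfolding set_lebesgue_integral_def by (rule integral_norm_bound)
    also have "\<dots> \<le> (LINT x|lborel. indicator {p..q} x + (cmod (v x))\<^sup>2)"
    proof (rule integral_mono)
      show "integrable lborel (\<lambda>x. norm (indicator {p..q} x *\<^sub>R v x))"
        using iv[of p q] unfolding set_integrable_def by (rule integrable_norm)
      show "integrable lborel (\<lambda>x. indicator {p..q} x + (cmod (v x))\<^sup>2)"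
        using iv2 by (intro Bochner_Integration.integrable_add) (auto simp: that)
      fix x
      have "0 \<le> (cmod (v x) - 1 / 2)\<^sup>2" by simp
      then have "cmod (v x) \<le> 1 + (cmod (v x))\<^sup>2" by (simp add: power2_diff power_divide)
      then show "norm (indicator {p..q} x *\<^sub>R v x) \<le> indicator {p..q} x + (cmod (v x))\<^sup>2"
        by (auto simp: indicator_def)
    qed
    also have "\<dots> = (q - p) + V"
      using iv2 that by (subst Bochner_Integration.integral_add) (auto simp: V_def)
    finally show ?thesis .
  qed
  have "norm (g x) \<le> (norm (g 0) + V) + \<bar>x\<bar>" for x
  proof -
    have "norm (g x - g 0) \<le> \<bar>x\<bar> + V"
      using diff[of 0 x] diff[of x 0] by (cases "x \<ge> 0") (auto simp: norm_minus_commute)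
    then show ?thesis using norm_triangle_sub[of "g x" "g 0"] by linarith
  qed
  then show ?thesis by (rule that)
qed

text \<open>Continuity of f across S excludes point masses: for a continuous function the
  fundamental theorem of calculus tolerates finitely many exceptional points, and f times the test
  function vanishes at both ends of a large interval.\<close>

lemma is_weak_derivI_piecewise:
  fixes f D :: "real \<Rightarrow> complex"
  assumes f: "continuous_on UNIV f" and S: "finite S"
    and D: "\<And>x. x \<notin> S \<Longrightarrow> (f has_vector_derivative D x) (at x)" and DL2: "D \<in> L2"
  shows "is_weak_deriv f D"
  unfolding is_weak_deriv_def
proof (intro allI impI)
  fix \<phi> assume test: "test_function \<phi>"
  have d0: "\<phi> differentiable at x" and d1: "deriv \<phi> differentiable at x" for x
    using test[unfolded test_function_def, THEN conjunct1, rule_format, of 0 x]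
      test[unfolded test_function_def, THEN conjunct1, rule_format, of 1 x] by simp_all
  have der: "(\<phi> has_real_derivative deriv \<phi> x) (at x)" for x
    using d0[of x] DERIV_deriv_iff_real_differentiable by blast
  have cont: "continuous_on UNIV \<phi>" "continuous_on UNIV (deriv \<phi>)"
    using d0 d1 differentiable_imp_continuous_within continuous_at_imp_continuous_on by blast+
  have "bounded {x. \<phi> x \<noteq> 0}"
    using test compact_imp_bounded bounded_subset closure_subset unfolding test_function_def by metis
  then obtain R where R: "\<And>x. \<phi> x \<noteq> 0 \<Longrightarrow> \<bar>x\<bar> \<le> R" unfolding bounded_iff by auto
  have z0: "\<phi> x = 0" if "x \<notin> {-R..R}" for x using R[of x] that by (cases "\<phi> x = 0") auto
  have z1: "deriv \<phi> x = 0" if "x \<notin> {-R..R}" for x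
  proof -
    have "((\<lambda>x. 0) has_real_derivative 0) (at x)" by simp
    then have "(\<phi> has_real_derivative 0) (at x)"
      by (rule has_field_derivative_transform_within_open[where S = "- {-R..R}"]) (use that z0 in auto)
    then show ?thesis by (rule DERIV_imp_deriv)
  qed
  \<comment> \<open>Positive whatever the sign of R, and strictly beyond R, so that
    \<open>\<phi>\<close> vanishes at the endpoints too.\<close>
  define Q where "Q = \<bar>R\<bar> + 1"
  have zQ: "\<phi> x = 0" "deriv \<phi> x = 0" if "x \<notin> {-Q<..<Q}" for x
  proof -
    have "x \<notin> {-R..R}" using that by (auto simp: Q_def)
    then show "\<phi> x = 0" "deriv \<phi> x = 0" using z0 z1 by blast+
  qed
  have i1: "integrable lborel (\<lambda>x. f x * of_real (deriv \<phi> x))"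
    by (rule integrable_continuous_compact_support[of _ "-Q" Q])
      (auto intro!: continuous_intros f cont zQ)
  have i2: "integrable lborel (\<lambda>x. D x * of_real (\<phi> x))"
  proof -
    have "set_integrable lborel {-Q..Q} (\<lambda>x. of_real (\<phi> x) * D x)"
      by (intro set_integrable_mult_continuous L2_set_integrable DL2 continuous_intros cont)
    moreover have "(\<lambda>x. indicator {-Q..Q} x *\<^sub>R (of_real (\<phi> x) * D x)) = (\<lambda>x. D x * of_real (\<phi> x))"
    proof
      fix x
      show "indicator {-Q..Q} x *\<^sub>R (of_real (\<phi> x) * D x) = D x * of_real (\<phi> x)"
        using zQ(1)[of x] by (cases "x \<in> {-Q<..<Q}") (auto simp: indicator_def)
    qed
    ultimately show ?thesis by (simp add: set_integrable_def)
  qed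
  let ?h = "\<lambda>x. f x * of_real (deriv \<phi> x) + D x * of_real (\<phi> x)"
  have "(?h has_integral f Q * of_real (\<phi> Q) - f (-Q) * of_real (\<phi> (-Q))) {-Q..Q}"
  proof (rule fundamental_theorem_of_calculus_interior_strong[OF S])
    show "- Q \<le> Q" by (simp add: Q_def)
    show "continuous_on {- Q..Q} (\<lambda>x. f x * of_real (\<phi> x))"
      by (rule continuous_on_subset[OF _ subset_UNIV]) (intro continuous_intros f cont)
    fix x assume "x \<in> {- Q<..<Q} - S"
    then have "(f has_vector_derivative D x) (at x)" using D by auto
    moreover have "((\<lambda>x. of_real (\<phi> x) :: complex) has_vector_derivative of_real (deriv \<phi> x)) (at x)"
      using der[of x] by (auto simp: has_real_derivative_iff_has_vector_derivative intro: has_vector_derivative_of_real)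
    ultimately show "((\<lambda>x. f x * of_real (\<phi> x)) has_vector_derivative ?h x) (at x)"
      by (rule has_vector_derivative_mult)
  qed
  then have "(?h has_integral 0) {-Q..Q}" using zQ by simp
  then have "(?h has_integral 0) UNIV"
    by (rule has_integral_on_superset) (auto simp: zQ)
  moreover have "(?h has_integral (LINT x|lborel. ?h x)) UNIV"
    using i1 i2 by (intro has_integral_integral_lborel Bochner_Integration.integrable_add)
  ultimately have "(LINT x|lborel. ?h x) = 0" using has_integral_unique by blast
  then show "(LINT x|lborel. f x * of_real (deriv \<phi> x)) = - (LINT x|lborel. D x * of_real (\<phi> x))"
    using i1 i2 by (simp add: add_eq_0_iff2)
qed

text \<open>The two delta terms become jumps of f', namely z f(b) at b and -z f(-b) at -b.
  Integrating by parts on the three pieces, these jumps reproduce the point terms of the form, while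
  the boundary terms at infinity vanish. Decay is required with the second power of 1 + x^2 so that
  one factor is left after multiplication by x.\<close>

lemma L_HO_piecewise_eigenfunction:
  fixes f1 f2 f3 d1 d2 d3 :: "real \<Rightarrow> complex" and b C :: real and z \<mu> :: complex
  defines "f \<equiv> \<lambda>x. if x < -b then f1 x else if x \<le> b then f2 x else f3 x"
  assumes b: "b > 0"
    and f1: "\<And>x. (f1 has_vector_derivative d1 x) (at x)"
    and f2: "\<And>x. (f2 has_vector_derivative d2 x) (at x)"
    and f3: "\<And>x. (f3 has_vector_derivative d3 x) (at x)"
    and d1: "\<And>x. (d1 has_vector_derivative ((of_real x)\<^sup>2 - \<mu>) * f1 x) (at x)"
    and d2: "\<And>x. (d2 has_vector_derivative ((of_real x)\<^sup>2 - \<mu>) * f2 x) (at x)"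
    and d3: "\<And>x. (d3 has_vector_derivative ((of_real x)\<^sup>2 - \<mu>) * f3 x) (at x)"
    and match: "f1 (-b) = f2 (-b)" "f2 b = f3 b"
    and jump: "d3 b - d2 b = z * f2 b" "d2 (-b) - d1 (-b) = - z * f2 (-b)"
    and decay1: "\<And>x. x \<le> -b \<Longrightarrow> norm (f1 x) * (1 + x\<^sup>2)\<^sup>2 \<le> C" "\<And>x. x \<le> -b \<Longrightarrow> norm (d1 x) * (1 + x\<^sup>2)\<^sup>2 \<le> C"
    and decay3: "\<And>x. x \<ge> b \<Longrightarrow> norm (f3 x) * (1 + x\<^sup>2)\<^sup>2 \<le> C" "\<And>x. x \<ge> b \<Longrightarrow> norm (d3 x) * (1 + x\<^sup>2)\<^sup>2 \<le> C"
  shows "L_HO z b f (\<lambda>x. \<mu> * f x)"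
proof -
  define D where "D = (\<lambda>x. if x < -b then d1 x else if x \<le> b then d2 x else d3 x)"
  have cf: "continuous_on UNIV f1" "continuous_on UNIV f2" "continuous_on UNIV f3"
    and cd: "continuous_on UNIV d1" "continuous_on UNIV d2" "continuous_on UNIV d3"
    by (rule has_vector_derivative_imp_continuous_on_UNIV, fact f1 f2 f3 d1 d2 d3)+
  have [measurable]: "f1 \<in> borel_measurable borel" "f2 \<in> borel_measurable borel" "f3 \<in> borel_measurable borel"
    "d1 \<in> borel_measurable borel" "d2 \<in> borel_measurable borel" "d3 \<in> borel_measurable borel"
    using cf cd by (auto intro: borel_measurable_continuous_onI)
  \<comment> \<open>Clamping the argument of each piece turns f into a sum of continuous functions,
    thanks to the matching conditions at -b and b.\<close>
  have f_eq: "f x = f1 (min x (-b)) + (f2 (max (-b) (min x b)) - f2 (-b)) + (f3 (max x b) - f3 b)" for x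
    using match b by (auto simp: f_def min_def max_def)
  have contf: "continuous_on UNIV f"
    unfolding f_eq
    by (intro continuous_intros continuous_on_compose2[OF cf(1)] continuous_on_compose2[OF cf(2)]
        continuous_on_compose2[OF cf(3)]) auto
  have f_m [measurable]: "f \<in> borel_measurable borel" using contf by (rule borel_measurable_continuous_onI)
  have D_m [measurable]: "D \<in> borel_measurable borel" unfolding D_def by measurable
  obtain K where K: "\<And>x. norm (f x) * (1 + x\<^sup>2)\<^sup>2 \<le> K" "\<And>x. norm (D x) * (1 + x\<^sup>2)\<^sup>2 \<le> K"
  proof -
    have "\<exists>M. \<forall>x\<in>{-b..b}. norm (h x) * (1 + x\<^sup>2)\<^sup>2 \<le> M" if h: "continuous_on UNIV h" for h :: "real \<Rightarrow> complex"
    proof -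
      have "bounded ((\<lambda>x. norm (h x) * (1 + x\<^sup>2)\<^sup>2) ` {-b..b})"
        by (intro compact_imp_bounded compact_continuous_image continuous_intros continuous_on_subset[OF h]) auto
      then show ?thesis unfolding bounded_iff by (auto intro: order_trans[OF abs_ge_self])
    qed
    from this[OF cf(2)] this[OF cd(2)] obtain M1 M2 where
      M: "\<And>x. x \<in> {-b..b} \<Longrightarrow> norm (f2 x) * (1 + x\<^sup>2)\<^sup>2 \<le> M1" "\<And>x. x \<in> {-b..b} \<Longrightarrow> norm (d2 x) * (1 + x\<^sup>2)\<^sup>2 \<le> M2"
      by blast
    have "norm (f x) * (1 + x\<^sup>2)\<^sup>2 \<le> max C (max M1 M2)" for x
      using decay1(1)[of x] decay3(1)[of x] M(1)[of x] by (auto simp: f_def)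
    moreover have "norm (D x) * (1 + x\<^sup>2)\<^sup>2 \<le> max C (max M1 M2)" for x
      using decay1(2)[of x] decay3(2)[of x] M(2)[of x] by (auto simp: D_def)
    ultimately show ?thesis by (rule that)
  qed
  have weaken: "norm (c * w) * (1 + x\<^sup>2) \<le> m * K" if "norm w * (1 + x\<^sup>2)\<^sup>2 \<le> K" "norm c \<le> m * (1 + x\<^sup>2)"
    for w c :: complex and x m :: real
  proof -
    have "norm (c * w) * (1 + x\<^sup>2) \<le> (m * (1 + x\<^sup>2)) * norm w * (1 + x\<^sup>2)"
      unfolding norm_mult using that(2) by (intro mult_right_mono) auto
    also have "\<dots> = m * (norm w * (1 + x\<^sup>2)\<^sup>2)" by (simp add: power2_eq_square algebra_simps)
    also have "\<dots> \<le> m * K"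
    proof (rule mult_left_mono[OF that(1)])
      have "0 \<le> m * (1 + x\<^sup>2)" using order_trans[OF norm_ge_zero that(2)] .
      then show "0 \<le> m" by (simp add: zero_le_mult_iff add_nonneg_eq_0_iff add_nonneg_pos not_le)
        (smt (verit) zero_le_power2)
    qed
    finally show ?thesis .
  qed
  have fL2: "f \<in> L2"
  proof (rule L2_I)
    show "norm (f x) * (1 + x\<^sup>2) \<le> K" for x
      using weaken[OF K(1)[of x], of 1 1] by simp
  qed measurable
  have DL2: "D \<in> L2"
  proof (rule L2_I)
    show "norm (D x) * (1 + x\<^sup>2) \<le> K" for x
      using weaken[OF K(2)[of x], of 1 1] by simp
  qed measurable
  have xfL2: "(\<lambda>x. of_real x * f x) \<in> L2"
  proof (rule L2_I)
    fix x :: real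
    have "0 \<le> (\<bar>x\<bar> - 1 / 2)\<^sup>2" by simp
    then have "norm (of_real x :: complex) \<le> 1 * (1 + x\<^sup>2)" by (simp add: power2_diff power_divide)
    then show "norm (of_real x * f x) * (1 + x\<^sup>2) \<le> 1 * K" by (rule weaken[OF K(1)])
  qed measurable
  have weak: "is_weak_deriv f D"
  proof (rule is_weak_derivI_piecewise[OF contf _ _ DL2])
    show "finite {-b, b}" by simp
    fix x assume "x \<notin> {-b, b}"
    then consider "x < -b" | "-b < x" "x < b" | "x > b" by fastforce
    then show "(f has_vector_derivative D x) (at x)"
    proof cases
      case 1
      have "(f1 has_vector_derivative D x) (at x)" using f1[of x] 1 b by (simp add: D_def)
      then show ?thesis
        by (rule has_vector_derivative_transform_within_open[where S = "{..<-b}"]) (use 1 b in \<open>auto simp: f_def\<close>)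
    next
      case 2
      have "(f2 has_vector_derivative D x) (at x)" using f2[of x] 2 b by (simp add: D_def)
      then show ?thesis
        by (rule has_vector_derivative_transform_within_open[where S = "{-b<..<b}"]) (use 2 b in \<open>auto simp: f_def\<close>)
    next
      case 3
      have "(f3 has_vector_derivative D x) (at x)" using f3[of x] 3 b by (simp add: D_def)
      then show ?thesis
        by (rule has_vector_derivative_transform_within_open[where S = "{b<..}"]) (use 3 b in \<open>auto simp: f_def\<close>)
    qed
  qed
  have dom: "f \<in> form_dom_HO"
    using fL2 DL2 xfL2 contf weak by (auto simp: form_dom_HO_def H1_def)
  have wD: "AE x in lborel. weak_deriv f x = D x"
    by (rule weak_deriv_unique[OF contf _ DL2 _ weak]) (use form_dom_weak_deriv[OF dom] in auto)
  have "form_HO z b f g = L2_inner (\<lambda>x. \<mu> * f x) g" if gdom: "g \<in> form_dom_HO" for g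
  proof -
    define v where "v = weak_deriv g"
    note g = form_dom_weak_deriv[OF gdom, folded v_def]
    have iv: "set_integrable lborel {p..q} v" for p q by (rule L2_set_integrable[OF g(4)])
    have ivc: "set_integrable lborel {p..q} (\<lambda>x. cnj (v x))" for p q
      using integrable_cnj[OF iv[of p q, unfolded set_integrable_def]] by (simp add: set_integrable_def)
    have gv: "cnj (g q) - cnj (g p) = (LINT t:{p..q}|lborel. cnj (v t))" if "p \<le> q" for p q
    proof -
      have "cnj (g q - g p) = cnj (LINT t:{p..q}|lborel. v t)"
        using weak_deriv_FTC[OF g(2) iv g(5) that] by simp
      also have "\<dots> = (LINT t:{p..q}|lborel. cnj (v t))"
        using Bochner_Integration.integral_cnj[of lborel "\<lambda>t. indicator {p..q} t *\<^sub>R v t"] by (simp add: set_lebesgue_integral_def)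
      finally show ?thesis by simp
    qed
    have contg: "continuous_on UNIV (\<lambda>x. cnj (g x))" by (intro continuous_intros g)
    have parts: "((\<lambda>x. d x * cnj (v x) + (((of_real x)\<^sup>2 - \<mu>) * h x) * cnj (g x)) has_integral
        d q * cnj (g q) - d p * cnj (g p)) {p..q}"
      if "p \<le> q" "\<And>x. (d has_vector_derivative ((of_real x)\<^sup>2 - \<mu>) * h x) (at x)" "continuous_on UNIV h"
      for d h p q
      by (rule integration_by_parts_indefinite_integral[OF that(2) _ ivc contg that(1)])
        (auto intro!: continuous_intros that(3) gv)
    \<comment> \<open>The integrand of the form, without its point terms, minus \<mu> times that of
      the inner product; the form identity thus says that J integrates to minus
      \<open>jmp\<close>.\<close>
    define J where "J = (\<lambda>x. D x * cnj (v x) + (((of_real x)\<^sup>2 - \<mu>) * f x) * cnj (g x))"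
    define jmp where "jmp = z * (f b * cnj (g b) - f (-b) * cnj (g (-b)))"
    have hasint: "(J has_integral (D R * cnj (g R) - D (-R) * cnj (g (-R)) - jmp)) {-R..R}" if R: "R > b" for R
    proof -
      \<comment> \<open>D takes the middle value \<open>d2\<close> at both -b and b, so on the outer
        intervals it differs from \<open>d1\<close> or \<open>d3\<close> possibly at one
        endpoint.\<close>
      have "(J has_integral d1 (-b) * cnj (g (-b)) - d1 (-R) * cnj (g (-R))) {-R..-b}"
        by (rule has_integral_spike_finite[OF _ _ parts[OF _ d1 cf(1)], of "{-b}"])
          (use R in \<open>auto simp: J_def D_def f_def\<close>)
      moreover have "(J has_integral d2 b * cnj (g b) - d2 (-b) * cnj (g (-b))) {-b..b}"
        by (rule has_integral_spike_finite[OF _ _ parts[OF _ d2 cf(2)], of "{-b}"])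
          (use b in \<open>auto simp: J_def D_def f_def\<close>)
      moreover have "(J has_integral d3 R * cnj (g R) - d3 b * cnj (g b)) {b..R}"
        by (rule has_integral_spike_finite[OF _ _ parts[OF _ d3 cf(3)], of "{b}"])
          (use R b in \<open>auto simp: J_def D_def f_def\<close>)
      ultimately have "(J has_integral (d1 (-b) * cnj (g (-b)) - d1 (-R) * cnj (g (-R)))
          + (d2 b * cnj (g b) - d2 (-b) * cnj (g (-b))) + (d3 R * cnj (g R) - d3 b * cnj (g b))) {-R..R}"
        using R b by (intro has_integral_combine[of _ b] has_integral_combine[of _ "-b"]) auto
      moreover have "d3 b = d2 b + z * f2 b" "d1 (-b) = d2 (-b) + z * f2 (-b)" using jump by (auto simp: algebra_simps)
      ultimately show ?thesis
        using R b by (simp add: jmp_def D_def f_def algebra_simps)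
    qed
    have iD: "integrable lborel (\<lambda>x. D x * cnj (v x))" by (rule L2_mult_cnj_integrable[OF DL2 g(4)])
    have ix: "integrable lborel (\<lambda>x. (of_real x * f x) * cnj (of_real x * g x))"
      by (rule L2_mult_cnj_integrable[OF xfL2 g(3)])
    have ifg: "integrable lborel (\<lambda>x. f x * cnj (g x))" by (rule L2_mult_cnj_integrable[OF fL2 g(1)])
    have J_eq: "J = (\<lambda>x. D x * cnj (v x) + ((of_real x * f x) * cnj (of_real x * g x) - \<mu> * (f x * cnj (g x))))"
      by (auto simp: J_def power2_eq_square algebra_simps)
    have iJ: "integrable lborel J" unfolding J_eq using iD ix ifg by simp
    have int_J: "(LINT x|lborel. J x) = (LINT x|lborel. D x * cnj (v x))
        + ((LINT x|lborel. (of_real x * f x) * cnj (of_real x * g x)) - \<mu> * (LINT x|lborel. f x * cnj (g x)))"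
    proof -
      have im: "integrable lborel (\<lambda>x. \<mu> * (f x * cnj (g x)))" using ifg by (rule integrable_mult_right)
      show ?thesis
        unfolding J_eq Bochner_Integration.integral_add[OF iD Bochner_Integration.integrable_diff[OF ix im]]
          Bochner_Integration.integral_diff[OF ix im] integral_mult_right_zero ..
    qed
    define R where "R = (\<lambda>n. b + 1 + real n)"
    have "(\<lambda>n. LINT x:{-R n..R n}|lborel. J x) \<longlonglongrightarrow> (LINT x|lborel. J x)"
      unfolding set_lebesgue_integral_def
    proof (rule integral_dominated_convergence[where w = "\<lambda>x. norm (J x)"])
      show "AE x in lborel. (\<lambda>n. indicator {-R n..R n} x *\<^sub>R J x) \<longlonglongrightarrow> J x"
      proof (intro AE_I2 tendsto_eventually)
        fix x
        obtain N where "real N \<ge> \<bar>x\<bar>" using real_arch_simple by blast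
        then show "\<forall>\<^sub>F n in sequentially. indicator {-R n..R n} x *\<^sub>R J x = J x"
          unfolding eventually_sequentially using b by (intro exI[of _ N]) (auto simp: R_def indicator_def)
      qed
    qed (use iJ in \<open>auto simp: indicator_def\<close>)
    moreover have "(LINT x:{-R n..R n}|lborel. J x) = D (R n) * cnj (g (R n)) - D (- R n) * cnj (g (- R n)) - jmp" for n
    proof -
      have "set_integrable lborel {-R n..R n} J"
        unfolding set_integrable_def using iJ by (intro integrable_mult_indicator) auto
      then have "(LINT x:{-R n..R n}|lborel. J x) = integral {-R n..R n} J"
        by (rule set_borel_integral_eq_integral)
      also have "\<dots> = D (R n) * cnj (g (R n)) - D (- R n) * cnj (g (- R n)) - jmp"
        by (rule integral_unique[OF hasint]) (simp add: R_def)
      finally show ?thesis .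
    qed
    moreover have "(\<lambda>n. D (R n) * cnj (g (R n)) - D (- R n) * cnj (g (- R n)) - jmp) \<longlonglongrightarrow> 0 - 0 - jmp"
    proof (intro tendsto_intros)
      obtain A where A: "\<And>x. norm (g x) \<le> A + \<bar>x\<bar>" using form_dom_linear_growth[OF gdom] by blast
      have bound: "norm (D x * cnj (g x)) \<le> K * ((A + \<bar>x\<bar>) / (1 + x\<^sup>2))" for x
      proof -
        have p: "1 + x\<^sup>2 > 0" by (simp add: add_pos_nonneg)
        have "norm (1 * D x) * (1 + x\<^sup>2) \<le> 1 * K" by (rule weaken[OF K(2)]) simp
        then have "norm (D x) \<le> K / (1 + x\<^sup>2)" using p by (simp add: pos_le_divide_eq)
        then have "norm (D x) * norm (g x) \<le> K / (1 + x\<^sup>2) * (A + \<bar>x\<bar>)"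
          using A[of x] by (intro mult_mono) (auto intro: order_trans[OF norm_ge_zero])
        then show ?thesis by (simp add: norm_mult)
      qed
      have lim: "(\<lambda>n. K * ((A + \<bar>R n\<bar>) / (1 + (R n)\<^sup>2))) \<longlonglongrightarrow> 0"
        unfolding R_def using b by real_asymp
      show "(\<lambda>n. D (R n) * cnj (g (R n))) \<longlonglongrightarrow> 0"
        by (rule Lim_null_comparison[OF _ lim]) (use bound in auto)
      show "(\<lambda>n. D (- R n) * cnj (g (- R n))) \<longlonglongrightarrow> 0"
        by (rule Lim_null_comparison[OF _ lim]) (use bound[of "- R _"] in auto)
    qed
    ultimately have main: "(LINT x|lborel. J x) = - jmp" using LIMSEQ_unique by fastforce
    have "L2_inner (weak_deriv f) (weak_deriv g) = (LINT x|lborel. D x * cnj (v x))"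
      unfolding L2_inner_def v_def
    proof (rule integral_cong_AE)
      show "(\<lambda>x. weak_deriv f x * cnj (weak_deriv g x)) \<in> borel_measurable lborel"
        by (rule borel_measurable_integrable[OF L2_mult_cnj_integrable])
          (use form_dom_weak_deriv(4)[OF dom] form_dom_weak_deriv(4)[OF gdom] in auto)
      show "(\<lambda>x. D x * cnj (weak_deriv g x)) \<in> borel_measurable lborel"
        using borel_measurable_integrable[OF iD] by (simp add: v_def)
      show "AE x in lborel. weak_deriv f x * cnj (weak_deriv g x) = D x * cnj (weak_deriv g x)"
        using wD by eventually_elim simp
    qed
    then have "form_HO z b f g = (LINT x|lborel. D x * cnj (v x))
        + (LINT x|lborel. (of_real x * f x) * cnj (of_real x * g x)) + jmp"
      by (simp add: form_HO_def jmp_def L2_inner_def)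
    also have "\<dots> = \<mu> * (LINT x|lborel. f x * cnj (g x))"
      using main int_J by (simp add: algebra_simps)
    also have "\<dots> = L2_inner (\<lambda>x. \<mu> * f x) g"
      by (simp add: L2_inner_def mult.assoc)
    finally show ?thesis .
  qed
  moreover have "(\<lambda>x. \<mu> * f x) \<in> L2"
    using fL2 by (auto simp: L2_def norm_mult power_mult_distrib)
  ultimately show ?thesis using dom by (simp add: L_HO_def)
qed

section \<open>The decaying solution\<close>

text \<open>A majorant of f itself is enough: Cauchy's inequality on discs of radius r/2 bounds the
  derivative by 2 g / r, hence also the difference quotients, and dominated convergence
  applies.\<close>

lemma holomorphic_lebesgue_integral:
  fixes f :: "complex \<Rightarrow> 'a \<Rightarrow> complex"
  assumes r: "r > 0" and hol: "\<And>t. (\<lambda>z. f z t) holomorphic_on cball z0 r"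
    and meas: "\<And>z. z \<in> cball z0 r \<Longrightarrow> f z \<in> borel_measurable M"
    and g: "integrable M g" and bound: "\<And>z t. z \<in> cball z0 r \<Longrightarrow> norm (f z t) \<le> g t"
  shows "((\<lambda>z. LINT t|M. f z t) has_field_derivative (LINT t|M. deriv (\<lambda>z. f z t) z0)) (at z0)"
proof -
  have int: "integrable M (f z)" if "z \<in> cball z0 r" for z
    by (rule Bochner_Integration.integrable_bound[OF g meas[OF that]])
      (use bound[OF that] in \<open>auto intro: order_trans[OF _ abs_ge_self]\<close>)
  have hol': "(\<lambda>z. f z t) holomorphic_on ball z0 r" for t
    using hol by (rule holomorphic_on_subset) auto
  have deriv_bound: "norm (deriv (\<lambda>z. f z t) w) \<le> g t / (r / 2)" if "w \<in> ball z0 (r / 2)" for w t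
  proof -
    have sub: "cball w (r / 2) \<subseteq> cball z0 r"
      using that by (intro cball_subset_cball_iff[THEN iffD2]) (auto simp: dist_commute)
    have "norm ((deriv ^^ 1) (\<lambda>z. f z t) w) \<le> fact 1 * g t / (r / 2) ^ 1"
    proof (rule Cauchy_inequality)
      show "(\<lambda>z. f z t) holomorphic_on ball w (r / 2)"
        using hol by (rule holomorphic_on_subset) (use sub ball_subset_cball in blast)
      show "continuous_on (cball w (r / 2)) (\<lambda>z. f z t)"
        using holomorphic_on_imp_continuous_on[OF hol] sub by (rule continuous_on_subset)
      fix z assume "norm (w - z) = r / 2"
      then show "norm (f z t) \<le> g t" using sub by (intro bound) (auto simp: dist_norm)
    qed (use r in auto)
    then show ?thesis by simp
  qed
  have lip: "norm (f z t - f z0 t) \<le> g t / (r / 2) * norm (z - z0)" if "z \<in> ball z0 (r / 2)" for z t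
  proof (rule field_differentiable_bound[of "ball z0 (r / 2)" _ "deriv (\<lambda>z. f z t)"])
    fix w assume w: "w \<in> ball z0 (r / 2)"
    then have "w \<in> ball z0 r" using r by auto
    then have "((\<lambda>z. f z t) has_field_derivative deriv (\<lambda>z. f z t) w) (at w)"
      using holomorphic_derivI[OF hol'] by auto
    then show "((\<lambda>z. f z t) has_field_derivative deriv (\<lambda>z. f z t) w) (at w within ball z0 (r / 2))"
      by (rule has_field_derivative_at_within)
    show "norm (deriv (\<lambda>z. f z t) w) \<le> g t / (r / 2)" by (rule deriv_bound[OF w])
  qed (use that r in auto)
  let ?B = "ball z0 (r / 2)"
  have "((\<lambda>z. ((LINT t|M. f z t) - (LINT t|M. f z0 t)) / (z - z0)) \<longlongrightarrow> (LINT t|M. deriv (\<lambda>z. f z t) z0)) (at z0 within ?B)"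
    \<comment> \<open>Dominated convergence works along sequences; the sequence of quotients also
      shows that the derivative is measurable in t.\<close>
    unfolding tendsto_at_iff_sequentially comp_def
  proof (intro allI impI)
    fix X assume X: "\<forall>i. X i \<in> ?B - {z0}" and lim: "X \<longlonglongrightarrow> z0"
    have XB: "X i \<in> ?B" "X i \<noteq> z0" "X i \<in> cball z0 r" for i
      using X r by (auto simp: dist_norm intro: less_imp_le) (smt (verit) dist_norm mem_ball field_sum_of_halves X DiffD1)
    have z0: "z0 \<in> cball z0 r" using r by simp
    let ?q = "\<lambda>i t. (f (X i) t - f z0 t) / (X i - z0)"
    have q_lim: "(\<lambda>i. ?q i t) \<longlonglongrightarrow> deriv (\<lambda>z. f z t) z0" for t
    proof -
      have "((\<lambda>z. f z t) has_field_derivative deriv (\<lambda>z. f z t) z0) (at z0)"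
        using holomorphic_derivI[OF hol'] r by auto
      then have "((\<lambda>z. (f z t - f z0 t) / (z - z0)) \<longlongrightarrow> deriv (\<lambda>z. f z t) z0) (at z0)"
        by (simp add: has_field_derivative_iff)
      then show ?thesis using XB(2) lim unfolding tendsto_at_iff_sequentially comp_def by auto
    qed
    have q_meas: "?q i \<in> borel_measurable M" for i
      using meas[OF XB(3)[of i]] meas[OF z0] by measurable
    have q_int: "(\<lambda>i. LINT t|M. ?q i t) \<longlonglongrightarrow> (LINT t|M. deriv (\<lambda>z. f z t) z0)"
    proof (rule integral_dominated_convergence[where w = "\<lambda>t. g t / (r / 2)"])
      show "(\<lambda>t. deriv (\<lambda>z. f z t) z0) \<in> borel_measurable M"
        by (rule borel_measurable_LIMSEQ_metric[OF q_meas q_lim])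
      show "integrable M (\<lambda>t. g t / (r / 2))" using g by simp
      show "AE t in M. norm (?q i t) \<le> g t / (r / 2)" for i
      proof (intro AE_I2)
        fix t
        show "norm (?q i t) \<le> g t / (r / 2)"
          using lip[OF XB(1)[of i], of t] XB(2)[of i] by (simp add: norm_divide divide_le_eq)
      qed
    qed (use q_meas q_lim in auto)
    have q_eq: "(LINT t|M. ?q i t) = ((LINT t|M. f (X i) t) - (LINT t|M. f z0 t)) / (X i - z0)" for i
      using int[OF XB(3)] int[OF z0] by simp
    show "(\<lambda>i. ((LINT t|M. f (X i) t) - (LINT t|M. f z0 t)) / (X i - z0)) \<longlonglongrightarrow> (LINT t|M. deriv (\<lambda>z. f z t) z0)"
      using q_int unfolding q_eq .
  qed
  then show ?thesis
    using r by (simp add: has_field_derivative_iff at_within_open[of z0 ?B])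
qed

text \<open>With $v(x)=\int_0^\infty t^{s-1}e^{-t^2/4-xt}\,dt$, the function $e^{-x^2/2}v(x)$ solves the
  oscillator equation with $\lambda=1-2s$. The integral only converges for $\mathrm{Re}\,s>0$, whereas the
  zeros that matter lie at $s<0$.\<close>

definition hermite_kernel :: "complex \<Rightarrow> complex \<Rightarrow> real \<Rightarrow> complex" where
  "hermite_kernel s x t =
     indicator {0<..} t *\<^sub>R (of_real t powr (s - 1) * exp (- (of_real t)\<^sup>2 / 4 - x * of_real t))"

lemma norm_hermite_kernel:
  "norm (hermite_kernel s x t) = indicator {0<..} t * (t powr (Re s - 1) * exp (- t\<^sup>2 / 4 - Re x * t))"
proof (cases "t > 0")
  case True
  then have "Re (- (of_real t)\<^sup>2 / 4 - x * of_real t) = - t\<^sup>2 / 4 - Re x * t"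
    by (simp flip: of_real_power)
  then show ?thesis using True
    by (simp add: hermite_kernel_def norm_mult norm_powr_real_powr)
qed (simp add: hermite_kernel_def)

text \<open>A single integrable bound for all a \<le> Re s \<le> c and Re x \<ge> -R. The power
  t^(Re s - 1) is at most t^(a-1) for t \<le> 1 and at most t^(c-1) beyond; completing the square
  gives -t^2/4 + R t \<le> (R + 1)^2 - t, whence the constant and the factor exp(-t).\<close>

definition hermite_majorant :: "real \<Rightarrow> real \<Rightarrow> real \<Rightarrow> real \<Rightarrow> real" where
  "hermite_majorant a c R t =
     exp ((R + 1)\<^sup>2) * (indicator {0<..} t * (t powr (a - 1) * exp (- t)) + indicator {0<..} t * (t powr (c - 1) * exp (- t)))"

lemma integrable_Gamma_kernel:
  assumes "a > 0"
  shows "integrable lborel (\<lambda>t::real. indicator {0<..} t * (t powr (a - 1) * exp (- t)))"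
proof -
  have "(\<lambda>t. complex_of_real t powr (of_real a - 1) / of_real (exp t)) absolutely_integrable_on {0<..}"
    using assms by (intro absolutely_integrable_Gamma_integral') auto
  then have "integrable lebesgue (\<lambda>t. norm (indicator {0<..} t *\<^sub>R (complex_of_real t powr (of_real a - 1) / of_real (exp t))))"
    unfolding set_integrable_def by (rule integrable_norm)
  also have "(\<lambda>t. norm (indicator {0<..} t *\<^sub>R (complex_of_real t powr (of_real a - 1) / of_real (exp t))))
      = (\<lambda>t. indicator {0<..} t * (t powr (a - 1) * exp (- t)))"
  proof
    fix t :: real
    show "norm (indicator {0<..} t *\<^sub>R (complex_of_real t powr (of_real a - 1) / of_real (exp t)))
        = indicator {0<..} t * (t powr (a - 1) * exp (- t))"
      by (cases "t > 0") (simp_all add: norm_mult norm_inverse norm_powr_real_powr exp_minus divide_inverse)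
  qed
  finally show ?thesis by (subst (asm) integrable_completion) auto
qed

lemma integrable_hermite_majorant: "a > 0 \<Longrightarrow> c > 0 \<Longrightarrow> integrable lborel (hermite_majorant a c R)"
  unfolding hermite_majorant_def
  by (intro integrable_mult_right Bochner_Integration.integrable_add integrable_Gamma_kernel)

lemma hermite_kernel_le_majorant:
  assumes "a \<le> Re s" "Re s \<le> c" "- R \<le> Re x"
  shows "norm (hermite_kernel s x t) \<le> hermite_majorant a c R t"
proof (cases "t > 0")
  case True
  have "t powr (Re s - 1) \<le> t powr (a - 1) + t powr (c - 1)"
  proof (cases "t \<le> 1")
    case True
    then have "t powr (Re s - 1) \<le> t powr (a - 1)" using \<open>t > 0\<close> assms by (intro powr_mono') auto
    then show ?thesis by (simp add: add_increasing2)
  next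
    case False
    then have "t powr (Re s - 1) \<le> t powr (c - 1)" using assms by (intro powr_mono) auto
    then show ?thesis by (simp add: add_increasing)
  qed
  moreover have "exp (- t\<^sup>2 / 4 - Re x * t) \<le> exp ((R + 1)\<^sup>2) * exp (- t)"
  proof -
    have "0 \<le> (t / 2 - (R + 1))\<^sup>2" by simp
    then have "- t\<^sup>2 / 4 + R * t \<le> (R + 1)\<^sup>2 - t" by (simp add: power2_eq_square field_simps)
    moreover have "- Re x * t \<le> R * t" using assms True by (intro mult_right_mono) auto
    ultimately have "- t\<^sup>2 / 4 - Re x * t \<le> (R + 1)\<^sup>2 + - t" by simp
    then show ?thesis unfolding exp_add[symmetric] by simp
  qed
  ultimately have "t powr (Re s - 1) * exp (- t\<^sup>2 / 4 - Re x * t)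
      \<le> (t powr (a - 1) + t powr (c - 1)) * (exp ((R + 1)\<^sup>2) * exp (- t))"
    by (intro mult_mono) auto
  then show ?thesis using True
    by (simp add: norm_hermite_kernel hermite_majorant_def algebra_simps)
qed (simp add: hermite_kernel_def hermite_majorant_def)

lemma hermite_kernel_measurable [measurable]: "hermite_kernel s x \<in> borel_measurable lborel"
proof -
  have "(\<lambda>t. indicator {0<..} t *\<^sub>R (of_real t powr (s - 1) * exp (- (of_real t)\<^sup>2 / 4 - x * of_real t)))
      \<in> borel_measurable (borel :: real measure)"
    by (intro borel_measurable_continuous_on_indicator) (auto intro!: continuous_intros)
  then show ?thesis by (simp add: hermite_kernel_def[abs_def])
qed

lemma integrable_hermite_kernel:
  assumes "Re s > 0" shows "integrable lborel (hermite_kernel s x)"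
  by (rule Bochner_Integration.integrable_bound[OF integrable_hermite_majorant[OF assms assms, of "\<bar>Re x\<bar>"]])
    (auto intro!: order_trans[OF hermite_kernel_le_majorant abs_ge_self])

definition hermite_integral :: "complex \<Rightarrow> complex \<Rightarrow> complex" where
  "hermite_integral s x = (LINT t|lborel. hermite_kernel s x t)"

lemma hermite_integral_holomorphic:
  "(\<lambda>s. hermite_integral s x) holomorphic_on {s. Re s > 0}"
proof (rule holomorphic_onI)
  fix s0 assume "s0 \<in> {s. Re s > 0}"
  then have s0: "Re s0 > 0" by simp
  \<comment> \<open>Half the distance to the imaginary axis, which keeps Re s bounded away from 0 on
    the closed disc.\<close>
  define r where "r = Re s0 / 2"
  have r: "r > 0" using s0 by (simp add: r_def)
  have near: "Re s0 - r \<le> Re s \<and> Re s \<le> Re s0 + r" if "s \<in> cball s0 r" for s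
    using abs_Re_le_cmod[of "s - s0"] that by (auto simp: dist_norm norm_minus_commute abs_le_iff)
  have "((\<lambda>s. LINT t|lborel. hermite_kernel s x t) has_field_derivative
      (LINT t|lborel. deriv (\<lambda>s. hermite_kernel s x t) s0)) (at s0)"
  proof (rule holomorphic_lebesgue_integral[OF r])
    show "(\<lambda>s. hermite_kernel s x t) holomorphic_on cball s0 r" for t
      unfolding hermite_kernel_def indicator_def
      by (cases "t > 0") (auto intro!: holomorphic_intros simp: scaleR_conv_of_real)
    show "integrable lborel (hermite_majorant (Re s0 - r) (Re s0 + r) \<bar>Re x\<bar>)"
      by (rule integrable_hermite_majorant) (use s0 in \<open>auto simp: r_def\<close>)
    show "norm (hermite_kernel s x t) \<le> hermite_majorant (Re s0 - r) (Re s0 + r) \<bar>Re x\<bar> t"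
      if "s \<in> cball s0 r" for s t
      using near[OF that] by (intro hermite_kernel_le_majorant) auto
  qed measurable
  then show "(\<lambda>s. hermite_integral s x) field_differentiable at s0 within {s. Re s > 0}"
    unfolding hermite_integral_def[abs_def]
    using field_differentiable_at_within field_differentiable_def by blast
qed

text \<open>Differentiating exp(-x t) in x produces a factor -t, which raises the exponent s - 1 by
  one.\<close>

lemma hermite_integral_derivative:
  assumes s: "Re s > 0"
  shows "(hermite_integral s has_field_derivative - hermite_integral (s + 1) x) (at x)"
proof -
  have "((\<lambda>x. LINT t|lborel. hermite_kernel s x t) has_field_derivative
      (LINT t|lborel. deriv (\<lambda>x. hermite_kernel s x t) x)) (at x)"
  proof (rule holomorphic_lebesgue_integral[of 1])
    show "(\<lambda>x. hermite_kernel s x t) holomorphic_on cball x 1" for t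
      unfolding hermite_kernel_def by (auto intro!: holomorphic_intros simp: scaleR_conv_of_real)
    show "integrable lborel (hermite_majorant (Re s) (Re s) (\<bar>Re x\<bar> + 1))"
      using s by (intro integrable_hermite_majorant)
    show "norm (hermite_kernel s y t) \<le> hermite_majorant (Re s) (Re s) (\<bar>Re x\<bar> + 1) t"
      if "y \<in> cball x 1" for y t
      using abs_Re_le_cmod[of "y - x"] that
      by (intro hermite_kernel_le_majorant) (auto simp: dist_norm norm_minus_commute abs_le_iff)
  qed (simp, measurable)
  moreover have "deriv (\<lambda>x. hermite_kernel s x t) x = - hermite_kernel (s + 1) x t" for t
  proof (rule DERIV_imp_deriv, cases "t > 0")
    case True
    have "((\<lambda>x. of_real t powr (s - 1) * exp (- (of_real t)\<^sup>2 / 4 - x * of_real t)) has_field_derivative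
        - (of_real t powr (s - 1) * of_real t * exp (- (of_real t)\<^sup>2 / 4 - x * of_real t))) (at x)"
      by (auto intro!: derivative_eq_intros)
    moreover have "of_real t powr (s - 1) * of_real t = complex_of_real t powr s"
      using True by (simp add: powr_diff)
    ultimately show "((\<lambda>x. hermite_kernel s x t) has_field_derivative - hermite_kernel (s + 1) x t) (at x)"
      using True by (simp add: hermite_kernel_def)
  qed (simp add: hermite_kernel_def)
  ultimately show ?thesis by (simp add: hermite_integral_def[abs_def])
qed

text \<open>Integrate the t-derivative of t^s exp(-t^2/4 - x t) over (0, \<infinity>); for Re s > 0
  both boundary values vanish.\<close>

lemma hermite_integral_rec:
  assumes s: "Re s > 0"
  shows "s * hermite_integral s x = x * hermite_integral (s + 1) x + hermite_integral (s + 2) x / 2"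
proof -
  define F where "F = (\<lambda>t::real. complex_of_real t powr s * exp (- (of_real t)\<^sup>2 / 4 - x * of_real t))"
  define f where "f = (\<lambda>t. s * hermite_kernel s x t - (x * hermite_kernel (s + 1) x t + hermite_kernel (s + 2) x t / 2))"
  define e where "e = (\<lambda>t::real. exp (- (complex_of_real t)\<^sup>2 / 4 - x * of_real t))"
  have f_pos: "f t = s * of_real t powr (s - 1) * e t - (of_real t / 2 + x) * (of_real t powr s * e t)" if "t > 0" for t
  proof -
    have "of_real t powr (s + 2 - 1) = of_real t * complex_of_real t powr s"
      using that powr_add[of "of_real t" s 1] by (simp add: algebra_simps)
    then show ?thesis using that
      by (simp add: f_def hermite_kernel_def e_def algebra_simps)
  qed
  have int: "integrable lborel (\<lambda>t. s * hermite_kernel s x t)" "integrable lborel (\<lambda>t. x * hermite_kernel (s + 1) x t)"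
    "integrable lborel (\<lambda>t. hermite_kernel (s + 2) x t / 2)"
    using s by (intro integrable_mult_right integrable_divide integrable_hermite_kernel; simp)+
  have nF: "norm (F t) = t powr Re s * exp (- t\<^sup>2 / 4 - Re x * t)" if "t > 0" for t
    using norm_hermite_kernel[of "s + 1" x t] that by (simp add: hermite_kernel_def F_def)
  have "(LBINT t=0..\<infinity>. f t) = 0 - 0"
  proof (rule interval_integral_FTC_integrable[where F = F])
    fix t assume "(0::ereal) < ereal t"
    then have t: "t > 0" by simp
    have "((\<lambda>z. z powr s * exp (- z\<^sup>2 / 4 - x * z)) has_field_derivative f t) (at (of_real t))"
      unfolding f_pos[OF t] e_def using t
      by (auto intro!: derivative_eq_intros simp: complex_nonpos_Reals_iff field_simps)
    then show "(F has_vector_derivative f t) (at t)"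
      unfolding F_def by (rule has_vector_derivative_real_field)
    have "continuous_on {0<..} (\<lambda>t::real. s * of_real t powr (s - 1) * e t - (of_real t / 2 + x) * (of_real t powr s * e t))"
      unfolding e_def by (auto intro!: continuous_intros)
    then have "continuous_on {0<..} f" by (rule continuous_on_cong[THEN iffD1, rotated 2]) (auto simp: f_pos)
    then show "isCont f t" using t by (simp add: continuous_on_eq_continuous_at)
  next
    have "integrable lborel f"
      unfolding f_def by (intro Bochner_Integration.integrable_diff Bochner_Integration.integrable_add int)
    then show "set_integrable lborel (einterval 0 \<infinity>) f"
      unfolding set_integrable_def by (intro integrable_mult_indicator) auto
    have "(F \<longlongrightarrow> 0) (at_right 0)"
    proof (rule tendsto_norm_zero_cancel, rule Lim_transform_eventually)
      show "((\<lambda>t::real. t powr Re s * exp (- t\<^sup>2 / 4 - Re x * t)) \<longlongrightarrow> 0) (at_right 0)"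
        using s by real_asymp
      show "\<forall>\<^sub>F t in at_right 0. t powr Re s * exp (- t\<^sup>2 / 4 - Re x * t) = norm (F t)"
        by (auto simp: eventually_at_filter nF)
    qed
    then show "((F \<circ> real_of_ereal) \<longlongrightarrow> 0) (at_right 0)"
      by (simp add: ereal_tendsto_simps zero_ereal_def)
    have "(F \<longlongrightarrow> 0) at_top"
    proof (rule tendsto_norm_zero_cancel, rule Lim_transform_eventually)
      show "((\<lambda>t::real. t powr Re s * exp (- t\<^sup>2 / 4 - Re x * t)) \<longlongrightarrow> 0) at_top"
        by real_asymp
      show "\<forall>\<^sub>F t in at_top. t powr Re s * exp (- t\<^sup>2 / 4 - Re x * t) = norm (F t)"
        using eventually_gt_at_top[of 0] by eventually_elim (simp add: nF)
    qed
    then show "((F \<circ> real_of_ereal) \<longlongrightarrow> 0) (at_left \<infinity>)"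
      by (simp add: ereal_tendsto_simps)
  qed simp
  moreover have "(LBINT t=0..\<infinity>. f t) = (LINT t|lborel. f t)"
    by (simp add: interval_lebesgue_integral_def set_lebesgue_integral_def)
      (intro Bochner_Integration.integral_cong, auto simp: f_def hermite_kernel_def indicator_def zero_ereal_def)
  moreover have "(LINT t|lborel. f t) = s * hermite_integral s x - (x * hermite_integral (s + 1) x + hermite_integral (s + 2) x / 2)"
    unfolding f_def hermite_integral_def using int by simp
  ultimately show ?thesis by simp
qed

text \<open>Dividing by $\Gamma(s)$ removes the poles at the non-positive integers and makes the coefficients of
  the recurrence polynomial in $s$; the recurrence then continues the function to all $s$.\<close>

definition hermite0 :: "complex \<Rightarrow> complex \<Rightarrow> complex" where
  "hermite0 s x = rGamma s * hermite_integral s x"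

lemma hermite0_rec:
  assumes "Re s > 0"
  shows "hermite0 s x = x * hermite0 (s + 1) x + (s + 1) / 2 * hermite0 (s + 2) x"
proof -
  have "hermite0 s x = rGamma (s + 1) * (s * hermite_integral s x)"
    using rGamma_plus1[of s] by (simp add: hermite0_def mult_ac)
  also have "\<dots> = x * (rGamma (s + 1) * hermite_integral (s + 1) x)
      + rGamma (s + 1) * hermite_integral (s + 2) x / 2"
    unfolding hermite_integral_rec[OF assms] by (simp add: algebra_simps)
  finally show ?thesis
    using rGamma_plus1[of "s + 1"] by (simp add: hermite0_def add.assoc)
qed

lemma hermite0_derivative:
  assumes "Re s > 0"
  shows "(hermite0 s has_field_derivative - s * hermite0 (s + 1) x) (at x)"
proof -
  have d: "((\<lambda>x. rGamma s * hermite_integral s x) has_field_derivative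
      rGamma s * (- hermite_integral (s + 1) x)) (at x)"
    by (intro DERIV_cmult hermite_integral_derivative assms)
  have e: "rGamma s * (- hermite_integral (s + 1) x) = - s * hermite0 (s + 1) x"
    unfolding hermite0_def by (subst rGamma_plus1[symmetric]) simp
  have f: "hermite0 s = (\<lambda>x. rGamma s * hermite_integral s x)"
    by (simp add: fun_eq_iff hermite0_def)
  show ?thesis using d unfolding e f .
qed

text \<open>Every unrolling moves the argument to the right by at least 1, so depth n refers to
  \<open>hermite0\<close> only at real parts of at least Re s + n. The value is therefore meaningful
  for Re s > -n.\<close>

fun hermite_ext :: "nat \<Rightarrow> complex \<Rightarrow> complex \<Rightarrow> complex" where
  "hermite_ext 0 s x = hermite0 s x"
| "hermite_ext (Suc n) s x = x * hermite_ext n (s + 1) x + (s + 1) / 2 * hermite_ext n (s + 2) x"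

lemma hermite_ext_Suc: "Re s > - real n \<Longrightarrow> hermite_ext (Suc n) s x = hermite_ext n s x"
proof (induction n arbitrary: s)
  case 0
  then show ?case using hermite0_rec[of s x] by simp
next
  case (Suc n)
  have "hermite_ext (Suc n) (s + 1) x = hermite_ext n (s + 1) x"
    "hermite_ext (Suc n) (s + 2) x = hermite_ext n (s + 2) x"
    using Suc.prems by (intro Suc.IH; simp)+
  then show ?case by (simp only: hermite_ext.simps)
qed

lemma hermite_ext_le: "n \<le> m \<Longrightarrow> Re s > - real n \<Longrightarrow> hermite_ext m s x = hermite_ext n s x"
proof (induction m rule: dec_induct)
  case (step m)
  then show ?case using hermite_ext_Suc[of m s x] by simp
qed simp

text \<open>The depth is the least n with Re s > -n. In classical terms, exp(-x^2/2) times
  \<open>pcf s x\<close> is 2^(s/2) D_{-s}(sqrt(2) x) with D the parabolic cylinder function, and at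
  s = -n \<open>pcf\<close> is the monic Hermite polynomial 2^(-n) H_n(x).\<close>

definition pcf :: "complex \<Rightarrow> complex \<Rightarrow> complex" where
  "pcf s x = hermite_ext (nat (\<lfloor>- Re s\<rfloor> + 1)) s x"

lemma pcf_eq:
  assumes "Re s > - real n" shows "pcf s x = hermite_ext n s x"
proof -
  let ?m = "nat (\<lfloor>- Re s\<rfloor> + 1)"
  have m: "Re s > - real ?m" by linarith
  show ?thesis
    using hermite_ext_le[of n ?m s x] hermite_ext_le[of ?m n s x] assms m
    by (cases "n \<le> ?m") (auto simp: pcf_def)
qed

lemma ex_nat_gt_neg: obtains n :: nat where "a > - real n"
  using reals_Archimedean2[of "- a"] by (metis minus_less_iff)

lemma pcf_rec: "pcf s x = x * pcf (s + 1) x + (s + 1) / 2 * pcf (s + 2) x"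
proof -
  obtain n where n: "Re s > - real n" by (rule ex_nat_gt_neg)
  have "pcf s x = hermite_ext (Suc n) s x" using n by (intro pcf_eq) simp
  moreover have "pcf (s + 1) x = hermite_ext n (s + 1) x" "pcf (s + 2) x = hermite_ext n (s + 2) x"
    using n by (intro pcf_eq; simp)+
  ultimately show ?thesis by simp
qed

text \<open>In the induction step, differentiating the recurrence for s yields
  \<open>pcf (s + 1) x\<close> minus (s + 1) times the right hand side of the recurrence for s + 1,
  which is again \<open>pcf (s + 1) x\<close>.\<close>

lemma pcf_derivative: "(pcf s has_field_derivative - s * pcf (s + 1) x) (at x)"
proof -
  have *: "(hermite_ext n s has_field_derivative - s * pcf (s + 1) x) (at x)" if "Re s > - real n" for n s
    using that
  proof (induction n arbitrary: s)
    case 0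
    then show ?case using hermite0_derivative[of s x] pcf_eq[of 0 "s + 1" x] by simp
  next
    case (Suc n)
    have d: "(hermite_ext n (s + 1) has_field_derivative - (s + 1) * pcf (s + 2) x) (at x)"
      "(hermite_ext n (s + 2) has_field_derivative - (s + 2) * pcf (s + 3) x) (at x)"
      using Suc.IH[of "s + 1"] Suc.IH[of "s + 2"] Suc.prems by (simp_all add: add.assoc)
    have v: "hermite_ext n (s + 1) x = pcf (s + 1) x"
      using Suc.prems by (intro pcf_eq[symmetric]) simp
    have "((\<lambda>x. x * hermite_ext n (s + 1) x + (s + 1) / 2 * hermite_ext n (s + 2) x) has_field_derivative
        (1 * hermite_ext n (s + 1) x + (- (s + 1) * pcf (s + 2) x) * x)
        + (s + 1) / 2 * (- (s + 2) * pcf (s + 3) x)) (at x)"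
      by (intro DERIV_add DERIV_mult DERIV_cmult DERIV_ident d)
    moreover have "(1 * hermite_ext n (s + 1) x + (- (s + 1) * pcf (s + 2) x) * x)
        + (s + 1) / 2 * (- (s + 2) * pcf (s + 3) x) = - s * pcf (s + 1) x"
    proof -
      have B: "x * pcf (s + 2) x + (s + 2) / 2 * pcf (s + 3) x = pcf (s + 1) x"
        using pcf_rec[of "s + 1" x] by (simp add: add.assoc)
      have A: "(1 * pcf (s + 1) x + (- (s + 1) * pcf (s + 2) x) * x)
          + (s + 1) / 2 * (- (s + 2) * pcf (s + 3) x)
        = pcf (s + 1) x - (s + 1) * (x * pcf (s + 2) x + (s + 2) / 2 * pcf (s + 3) x)"
        by (simp add: field_simps)
      show ?thesis unfolding v A B by (simp add: algebra_simps)
    qed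
    ultimately show ?case by simp
  qed
  obtain n where n: "Re s > - real n" by (rule ex_nat_gt_neg)
  then have "pcf s = hermite_ext n s" by (intro ext pcf_eq)
  with *[OF n] show ?thesis by simp
qed

text \<open>On the half-plane Re s > -n the function is \<open>hermite_ext n\<close>, a combination
  of translates of \<open>hermite0\<close> with coefficients polynomial in s; these half-planes
  exhaust the plane.\<close>

lemma pcf_holomorphic: "(\<lambda>s. pcf s x) holomorphic_on UNIV"
proof (rule holomorphic_onI)
  fix s0 :: complex
  obtain n where n: "Re s0 > - real n" by (rule ex_nat_gt_neg)
  have op: "open {s. Re s > - real n}" by (rule open_halfspace_Re_gt)
  have hol: "(\<lambda>s. hermite_ext n s x) holomorphic_on {s. Re s > - real n}"
  proof (induction n)
    case 0
    show ?case by (auto simp: hermite0_def intro!: holomorphic_intros hermite_integral_holomorphic[simplified])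
  next
    case (Suc n)
    have "(\<lambda>s. hermite_ext n (s + 1) x) holomorphic_on {s. Re s > - real (Suc n)}"
      "(\<lambda>s. hermite_ext n (s + 2) x) holomorphic_on {s. Re s > - real (Suc n)}"
      by (rule holomorphic_on_compose_gen[OF _ Suc, unfolded comp_def]; auto intro!: holomorphic_intros)+
    then show ?case by (auto intro!: holomorphic_intros)
  qed
  have "(\<lambda>s. pcf s x) holomorphic_on {s. Re s > - real n}"
    by (rule holomorphic_transform[OF hol]) (simp add: pcf_eq)
  then have "(\<lambda>s. pcf s x) field_differentiable (at s0)"
    using n op holomorphic_on_imp_differentiable_at by blast
  then show "(\<lambda>s. pcf s x) field_differentiable at s0 within UNIV" by simp
qed

section \<open>Reality and positivity at real parameters\<close>

lemma hermite_integral_real: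
  assumes "a > 0"
  obtains r where "hermite_integral (of_real a) (of_real x) = of_real r" "r > 0"
proof -
  let ?k = "\<lambda>t. norm (hermite_kernel (of_real a) (of_real x) t)"
  \<comment> \<open>At real arguments the kernel is nonnegative and equals its own norm, so the
    integral is real; it is not 0 because the kernel is positive on (0, 1).\<close>
  have eq: "hermite_kernel (of_real a) (of_real x) t = of_real (?k t)" for t
  proof (cases "t > 0")
    case True
    have "complex_of_real t powr (of_real a - 1) = of_real (t powr (a - 1))"
      using True powr_of_real[of t "a - 1"] by simp
    moreover have "exp (- (complex_of_real t)\<^sup>2 / 4 - of_real x * of_real t) = of_real (exp (- t\<^sup>2 / 4 - x * t))"
      by (simp flip: exp_of_real)
    ultimately show ?thesis using True
      by (simp add: norm_hermite_kernel) (simp add: hermite_kernel_def)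
  qed (simp add: hermite_kernel_def)
  have int: "integrable lborel ?k"
    using assms by (intro integrable_norm integrable_hermite_kernel) simp
  have "(LINT t|lborel. ?k t) \<noteq> 0"
  proof
    assume "(LINT t|lborel. ?k t) = 0"
    then have "AE t in lborel. ?k t = 0"
      using int by (subst (asm) integral_nonneg_eq_0_iff_AE) auto
    then have "AE t in lborel. t \<notin> {0<..<1::real}"
      by eventually_elim (auto simp: norm_hermite_kernel)
    then have "{0<..<1::real} \<in> null_sets lborel"
      by (subst AE_iff_null_sets) auto
    then have "emeasure lborel {0<..<1::real} = 0" by (rule null_setsD1)
    then show False by simp
  qed
  moreover have "(LINT t|lborel. ?k t) \<ge> 0" by (rule integral_nonneg_AE) simp
  moreover have "hermite_integral (of_real a) (of_real x) = of_real (LINT t|lborel. ?k t)"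
    unfolding hermite_integral_def Bochner_Integration.integral_cong[OF refl eq]
    by (rule integral_complex_of_real)
  ultimately show ?thesis by (intro that) (auto simp: less_le)
qed

lemma hermite0_real:
  assumes "a > 0"
  obtains r where "hermite0 (of_real a) (of_real x) = of_real r" "r > 0"
proof -
  obtain r where r: "hermite_integral (of_real a) (of_real x) = of_real r" "r > 0"
    using hermite_integral_real[OF assms] by blast
  have "hermite0 (of_real a) (of_real x) = of_real (rGamma a * r)"
    by (simp add: hermite0_def r rGamma_complex_of_real)
  moreover have "rGamma a * r > 0"
    using Gamma_real_pos[OF assms] r(2) by (simp add: rGamma_inverse_Gamma)
  ultimately show ?thesis by (rule that)
qed

lemma pcf_pos:
  assumes "a > 0" shows "Re (pcf (of_real a) (of_real x)) > 0"
proof -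
  obtain r where r: "hermite0 (of_real a) (of_real x) = of_real r" "r > 0"
    using hermite0_real[OF assms] by blast
  have "pcf (of_real a) (of_real x) = hermite_ext 0 (of_real a) (of_real x)"
    by (rule pcf_eq) (use assms in simp)
  then show ?thesis by (simp only: hermite_ext.simps r Re_complex_of_real)
qed

lemma pcf_real: "pcf (of_real a) (of_real x) \<in> \<real>"
proof -
  have "hermite_ext n (of_real a) (of_real x) \<in> \<real>" if "a > - real n" for n
    using that
  proof (induction n arbitrary: a)
    case 0
    then obtain r where "hermite0 (of_real a) (of_real x) = of_real r"
      using hermite0_real[of a x] by auto
    then show ?case by (simp only: hermite_ext.simps Reals_of_real)
  next
    case (Suc n)
    have "hermite_ext n (of_real (a + 1)) (of_real x) \<in> \<real>" "hermite_ext n (of_real (a + 2)) (of_real x) \<in> \<real>"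
      using Suc.prems by (intro Suc.IH; simp)+
    then show ?case by (auto intro!: Reals_add Reals_mult Reals_divide)
  qed
  moreover obtain n where n: "a > - real n" by (rule ex_nat_gt_neg)
  ultimately show ?thesis using pcf_eq[of n "of_real a" "of_real x"] by simp
qed

section \<open>Growth on the positive half-line and Gaussian decay\<close>

definition exp_bounded :: "(real \<Rightarrow> complex) \<Rightarrow> bool" where
  "exp_bounded h \<longleftrightarrow> (\<exists>C n. \<forall>x\<ge>0. norm (h x) \<le> C * exp (real n * x))"

lemma exp_bounded_const: "exp_bounded (\<lambda>x. c)"
  unfolding exp_bounded_def by (intro exI[of _ "norm c"] exI[of _ 0]) auto

lemma exp_bounded_id: "exp_bounded of_real"
  unfolding exp_bounded_def
proof (intro exI[of _ 1] exI[of _ "1::nat"] allI impI)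
  fix x :: real assume "x \<ge> 0"
  then show "norm (of_real x :: complex) \<le> 1 * exp (real 1 * x)"
    using order_trans[OF _ exp_ge_add_one_self[of x], of x] by simp
qed

lemma exp_bounded_mult:
  assumes "exp_bounded f" "exp_bounded g" shows "exp_bounded (\<lambda>x. f x * g x)"
proof -
  obtain C n C' n' where *: "\<And>x. x \<ge> 0 \<Longrightarrow> norm (f x) \<le> C * exp (real n * x)"
    "\<And>x. x \<ge> 0 \<Longrightarrow> norm (g x) \<le> C' * exp (real n' * x)"
    using assms unfolding exp_bounded_def by blast
  have "norm (f x * g x) \<le> (C * C') * exp (real (n + n') * x)" if "x \<ge> 0" for x
  proof -
    have "norm (f x) * norm (g x) \<le> (C * exp (real n * x)) * (C' * exp (real n' * x))"
      using *[OF that] by (intro mult_mono) (auto intro: order_trans[OF norm_ge_zero])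
    then show ?thesis by (simp add: norm_mult algebra_simps exp_add)
  qed
  then show ?thesis unfolding exp_bounded_def by blast
qed

lemma exp_bounded_add:
  assumes "exp_bounded f" "exp_bounded g" shows "exp_bounded (\<lambda>x. f x + g x)"
proof -
  obtain C n C' n' where *: "\<And>x. x \<ge> 0 \<Longrightarrow> norm (f x) \<le> C * exp (real n * x)"
    "\<And>x. x \<ge> 0 \<Longrightarrow> norm (g x) \<le> C' * exp (real n' * x)"
    using assms unfolding exp_bounded_def by blast
  have "norm (f x + g x) \<le> (\<bar>C\<bar> + \<bar>C'\<bar>) * exp (real (n + n') * x)" if "x \<ge> 0" for x
  proof -
    have "C * exp (real n * x) \<le> \<bar>C\<bar> * exp (real (n + n') * x)"
      "C' * exp (real n' * x) \<le> \<bar>C'\<bar> * exp (real (n + n') * x)"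
      using that by (intro mult_mono; simp add: mult_right_mono)+
    then show ?thesis using *[OF that] norm_triangle_ineq[of "f x" "g x"] by (simp add: distrib_right)
  qed
  then show ?thesis unfolding exp_bounded_def by blast
qed

text \<open>The growth class contains the identity and is closed under sums and products, so the
  unrolled recurrence never leaves it; for x \<ge> 0 the integral itself is bounded uniformly in
  x.\<close>

lemma exp_bounded_pcf: "exp_bounded (\<lambda>x. pcf s (of_real x))"
proof -
  have "exp_bounded (\<lambda>x. hermite_ext n s (of_real x))" if "Re s > - real n" for n
    using that
  proof (induction n arbitrary: s)
    case 0
    have "norm (hermite_integral s (of_real x)) \<le> (LINT t|lborel. hermite_majorant (Re s) (Re s) 0 t)" if "x \<ge> 0" for x
    proof -
      have "norm (hermite_integral s (of_real x)) \<le> (LINT t|lborel. norm (hermite_kernel s (of_real x) t))"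
        unfolding hermite_integral_def by (rule integral_norm_bound)
      also have "\<dots> \<le> (LINT t|lborel. hermite_majorant (Re s) (Re s) 0 t)"
        using 0 that by (intro integral_mono integrable_norm integrable_hermite_kernel
            integrable_hermite_majorant hermite_kernel_le_majorant) auto
      finally show ?thesis .
    qed
    then have "exp_bounded (\<lambda>x. hermite_integral s (of_real x))"
      unfolding exp_bounded_def
      by (intro exI[of _ "LINT t|lborel. hermite_majorant (Re s) (Re s) 0 t"] exI[of _ 0]) auto
    then show ?case by (simp add: hermite0_def exp_bounded_mult exp_bounded_const)
  next
    case (Suc n)
    have "exp_bounded (\<lambda>x. hermite_ext n (s + 1) (of_real x))" "exp_bounded (\<lambda>x. hermite_ext n (s + 2) (of_real x))"
      using Suc.prems by (intro Suc.IH; simp)+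
    then show ?case
      unfolding hermite_ext.simps by (intro exp_bounded_add exp_bounded_mult exp_bounded_const exp_bounded_id)
  qed
  moreover obtain n where n: "Re s > - real n" by (rule ex_nat_gt_neg)
  ultimately show ?thesis using pcf_eq[OF n] by simp
qed

lemma gaussian_decay:
  assumes "exp_bounded h"
  obtains C where "\<And>x. x \<ge> 0 \<Longrightarrow> norm (of_real (exp (- x\<^sup>2 / 2)) * h x) * (1 + x\<^sup>2)\<^sup>2 \<le> C"
proof -
  obtain C n where h: "\<And>x. x \<ge> 0 \<Longrightarrow> norm (h x) \<le> C * exp (real n * x)"
    using assms unfolding exp_bounded_def by blast
  have C: "C \<ge> 0" using order_trans[OF norm_ge_zero h[of 0]] by simp
  \<comment> \<open>The constant comes from (1 + x^2)^2 \<le> exp(4 x) and from completing the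
    square in -x^2/2 + (n + 4) x.\<close>
  have "norm (of_real (exp (- x\<^sup>2 / 2)) * h x) * (1 + x\<^sup>2)\<^sup>2 \<le> C * exp ((real n + 4)\<^sup>2 / 2)" if x: "x \<ge> 0" for x
  proof -
    have "1 + x\<^sup>2 \<le> (1 + x)\<^sup>2" using x by (simp add: power2_eq_square algebra_simps)
    also have "\<dots> \<le> (exp x)\<^sup>2" using x exp_ge_add_one_self[of x] by (intro power_mono) auto
    finally have "(1 + x\<^sup>2)\<^sup>2 \<le> ((exp x)\<^sup>2)\<^sup>2" by (intro power_mono) auto
    also have "((exp x)\<^sup>2)\<^sup>2 = exp (4 * x)" by (simp flip: exp_double power_mult add: exp_of_nat_mult[symmetric])
    finally have w: "(1 + x\<^sup>2)\<^sup>2 \<le> exp (4 * x)" .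
    have "norm (of_real (exp (- x\<^sup>2 / 2)) * h x) * (1 + x\<^sup>2)\<^sup>2
        \<le> (exp (- x\<^sup>2 / 2) * (C * exp (real n * x))) * exp (4 * x)"
      unfolding norm_mult using h[OF x] w C by (intro mult_mono) auto
    also have "\<dots> = C * exp (- x\<^sup>2 / 2 + real n * x + 4 * x)"
      by (simp only: exp_add mult_ac)
    also have "\<dots> \<le> C * exp ((real n + 4)\<^sup>2 / 2)"
    proof (intro mult_left_mono C)
      have "0 \<le> (x - (real n + 4))\<^sup>2" by simp
      then have "- x\<^sup>2 / 2 + real n * x + 4 * x \<le> (real n + 4)\<^sup>2 / 2"
        by (simp add: power2_eq_square algebra_simps)
      then show "exp (- x\<^sup>2 / 2 + real n * x + 4 * x) \<le> exp ((real n + 4)\<^sup>2 / 2)" by simp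
    qed
    finally show ?thesis .
  qed
  then show ?thesis by (rule that)
qed

definition psi :: "complex \<Rightarrow> real \<Rightarrow> complex" where
  "psi s x = of_real (exp (- x\<^sup>2 / 2)) * pcf s (of_real x)"

definition psi' :: "complex \<Rightarrow> real \<Rightarrow> complex" where
  "psi' s x = of_real (exp (- x\<^sup>2 / 2)) * ((- 1) * of_real x * pcf s (of_real x) + (- s) * pcf (s + 1) (of_real x))"

lemma gaussian_derivative:
  "((\<lambda>x. of_real (exp (- x\<^sup>2 / 2)) :: complex) has_vector_derivative of_real (- x * exp (- x\<^sup>2 / 2))) (at x)"
  by (rule has_vector_derivative_of_real) (auto intro!: derivative_eq_intros)

lemma pcf_vector_derivative:
  "((\<lambda>x. pcf s (of_real x)) has_vector_derivative - s * pcf (s + 1) (of_real x)) (at x)"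
  by (rule has_vector_derivative_real_field) (rule pcf_derivative)

lemma psi_derivative: "(psi s has_vector_derivative psi' s x) (at x)"
proof -
  have "((\<lambda>x. of_real (exp (- x\<^sup>2 / 2)) * pcf s (of_real x)) has_vector_derivative
      of_real (exp (- x\<^sup>2 / 2)) * (- s * pcf (s + 1) (of_real x))
      + of_real (- x * exp (- x\<^sup>2 / 2)) * pcf s (of_real x)) (at x)"
    by (rule has_vector_derivative_mult[OF gaussian_derivative pcf_vector_derivative])
  then show ?thesis by (simp add: psi_def[abs_def] psi'_def algebra_simps)
qed

text \<open>After the second differentiation the terms with \<open>pcf (s + 1)\<close> and
  \<open>pcf (s + 2)\<close> combine, by the recurrence at s, into 2 s times \<open>pcf s\<close>.
  This is the origin of the eigenvalue 1 - 2s.\<close>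

lemma psi'_derivative:
  "(psi' s has_vector_derivative ((of_real x)\<^sup>2 - (1 - 2 * s)) * psi s x) (at x)"
proof -
  let ?e = "of_real (exp (- x\<^sup>2 / 2)) :: complex"
  have "((\<lambda>x. (- 1) * of_real x * pcf s (of_real x) + (- s) * pcf (s + 1) (of_real x)) has_vector_derivative
      (((- 1) * of_real x * (- s * pcf (s + 1) (of_real x)) + ((- 1) * 1) * pcf s (of_real x))
      + (- s) * (- (s + 1) * pcf (s + 1 + 1) (of_real x)))) (at x)"
    by (intro has_vector_derivative_add has_vector_derivative_mult pcf_vector_derivative
        has_vector_derivative_mult_right has_vector_derivative_of_real has_vector_derivative_id)
      (auto intro!: derivative_eq_intros)
  from has_vector_derivative_mult[OF gaussian_derivative this]
  have "(psi' s has_vector_derivative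
      ?e * (((- 1) * of_real x * (- s * pcf (s + 1) (of_real x)) + ((- 1) * 1) * pcf s (of_real x))
      + (- s) * (- (s + 1) * pcf (s + 1 + 1) (of_real x)))
      + of_real (- x * exp (- x\<^sup>2 / 2)) * ((- 1) * of_real x * pcf s (of_real x) + (- s) * pcf (s + 1) (of_real x))) (at x)"
    by (simp only: psi'_def[abs_def])
  also have "?e * (((- 1) * of_real x * (- s * pcf (s + 1) (of_real x)) + ((- 1) * 1) * pcf s (of_real x))
      + (- s) * (- (s + 1) * pcf (s + 1 + 1) (of_real x)))
      + of_real (- x * exp (- x\<^sup>2 / 2)) * ((- 1) * of_real x * pcf s (of_real x) + (- s) * pcf (s + 1) (of_real x))
    = ?e * ((of_real x)\<^sup>2 * pcf s (of_real x) - pcf s (of_real x)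
        + 2 * s * (of_real x * pcf (s + 1) (of_real x) + (s + 1) / 2 * pcf (s + 2) (of_real x)))"
    by (simp add: algebra_simps power2_eq_square)
  also have "\<dots> = ((of_real x)\<^sup>2 - (1 - 2 * s)) * psi s x"
    unfolding pcf_rec[symmetric] by (simp add: psi_def algebra_simps)
  finally show ?thesis .
qed

lemma psi_decay:
  obtains C where "\<And>x. x \<ge> 0 \<Longrightarrow> norm (psi s x) * (1 + x\<^sup>2)\<^sup>2 \<le> C" "\<And>x. x \<ge> 0 \<Longrightarrow> norm (psi' s x) * (1 + x\<^sup>2)\<^sup>2 \<le> C"
proof -
  obtain C1 where C1: "\<And>x. x \<ge> 0 \<Longrightarrow> norm (psi s x) * (1 + x\<^sup>2)\<^sup>2 \<le> C1"
    unfolding psi_def using gaussian_decay[OF exp_bounded_pcf] by blast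
  have "exp_bounded (\<lambda>x. (- 1) * of_real x * pcf s (of_real x) + (- s) * pcf (s + 1) (of_real x))"
    by (intro exp_bounded_add exp_bounded_mult exp_bounded_const exp_bounded_id exp_bounded_pcf)
  from gaussian_decay[OF this] obtain C2 where C2: "\<And>x. x \<ge> 0 \<Longrightarrow> norm (psi' s x) * (1 + x\<^sup>2)\<^sup>2 \<le> C2"
    unfolding psi'_def by blast
  show ?thesis
    by (rule that[of "max C1 C2"]) (use C1 C2 in \<open>auto intro: max.coboundedI1 max.coboundedI2\<close>)
qed

lemma psi_holomorphic: "(\<lambda>s. psi s x) holomorphic_on UNIV"
  unfolding psi_def by (intro holomorphic_intros pcf_holomorphic)

lemma psi'_holomorphic: "(\<lambda>s. psi' s x) holomorphic_on UNIV"
proof -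
  have "(\<lambda>s. pcf (s + 1) (of_real x)) holomorphic_on UNIV"
    by (rule holomorphic_on_compose_gen[OF _ pcf_holomorphic, unfolded comp_def]) (auto intro!: holomorphic_intros)
  then show ?thesis unfolding psi'_def by (intro holomorphic_intros pcf_holomorphic)
qed

lemma psi_real: "psi (of_real a) x \<in> \<real>" "psi' (of_real a) x \<in> \<real>"
  using pcf_real[of a x] pcf_real[of "a + 1" x] unfolding psi_def psi'_def
  by (auto intro!: Reals_mult Reals_add simp: Reals_minus_iff)

text \<open>The plus sign is due to the reflection: psi(-x) has derivative -psi'(-x).\<close>

definition wronskian :: "complex \<Rightarrow> real \<Rightarrow> complex" where
  "wronskian s x = psi s (- x) * psi' s x + psi s x * psi' s (- x)"

text \<open>Since x^2 is even, psi(x) and psi(-x) solve the same equation. The value at b governs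
  the derivative jumps of the eigenfunction, whereas the value at 0 is the one that can be seen to
  be nonzero.\<close>

lemma wronskian_const: "wronskian s x = wronskian s 0"
proof -
  have r: "((\<lambda>x. psi s (- x)) has_vector_derivative - psi' s (- x)) (at x)"
    "((\<lambda>x. psi' s (- x)) has_vector_derivative - (((of_real x)\<^sup>2 - (1 - 2 * s)) * psi s (- x))) (at x)" for x
  proof -
    have n: "(uminus has_vector_derivative (-1::real)) (at x)"
      by (auto intro!: derivative_eq_intros)
    show "((\<lambda>x. psi s (- x)) has_vector_derivative - psi' s (- x)) (at x)"
      using vector_diff_chain_at[OF n psi_derivative] by (simp add: comp_def)
    show "((\<lambda>x. psi' s (- x)) has_vector_derivative - (((of_real x)\<^sup>2 - (1 - 2 * s)) * psi s (- x))) (at x)"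
      using vector_diff_chain_at[OF n psi'_derivative] by (simp add: comp_def)
  qed
  have "(wronskian s has_vector_derivative
      (psi s (- x) * (((of_real x)\<^sup>2 - (1 - 2 * s)) * psi s x) + (- psi' s (- x)) * psi' s x)
      + (psi s x * (- (((of_real x)\<^sup>2 - (1 - 2 * s)) * psi s (- x))) + psi' s x * psi' s (- x))) (at x)" for x
    unfolding wronskian_def[abs_def]
    by (intro has_vector_derivative_add has_vector_derivative_mult r psi_derivative psi'_derivative)
  then have "(wronskian s has_vector_derivative 0) (at x)" for x
    by (simp add: algebra_simps)
  then obtain c where "\<And>x. x \<in> UNIV \<Longrightarrow> wronskian s x = c"
    using has_vector_derivative_zero_constant[of UNIV "wronskian s"] by blast
  then show ?thesis by simp
qed

section \<open>Eigenvalues\<close>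

lemma L_HO_zero:
  assumes "b > 0" shows "L_HO z b (\<lambda>x. 0) (\<lambda>x. 0)"
  using L_HO_piecewise_eigenfunction[of b "\<lambda>x. 0" "\<lambda>x. 0" "\<lambda>x. 0" "\<lambda>x. 0" "\<lambda>x. 0" "\<lambda>x. 0" 0 z 0] assms
  by (simp cong: if_cong)

lemma continuous_AE_zero:
  fixes f :: "real \<Rightarrow> complex"
  assumes "continuous_on UNIV f" "AE x in lborel. f x = 0"
  shows "f x = 0"
proof (rule ccontr)
  assume "f x \<noteq> 0"
  have op: "open {y. f y \<noteq> 0}"
    using assms(1) by (intro open_Collect_neq) auto
  have "AE y in lborel. y \<notin> {y. f y \<noteq> 0}" using assms(2) by simp
  then have "{y. f y \<noteq> 0} \<in> null_sets lborel"
    using op by (subst AE_iff_null_sets) auto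
  then have "negligible {y. f y \<noteq> 0}"
    by (simp add: negligible_iff_null_sets null_sets_completionI)
  with op open_not_negligible \<open>f x \<noteq> 0\<close> show False by blast
qed

text \<open>It is injectivity that fails: f and the zero function both solve the equation for h = 0.
  As \<open>resolvent_set\<close> identifies functions that agree almost everywhere, continuity of f
  is what turns a single nonzero value into a contradiction.\<close>

lemma eigenvalue_in_Sp:
  assumes b: "b > 0" and f: "L_HO z b f (\<lambda>x. \<mu> * f x)" and nz: "f y \<noteq> 0"
  shows "\<mu> \<in> Sp (L_HO z b)"
proof (rule ccontr)
  assume "\<mu> \<notin> Sp (L_HO z b)"
  then have inj: "\<And>h f g. h \<in> L2 \<Longrightarrow> L_HO z b f (\<lambda>x. h x + \<mu> * f x) \<Longrightarrow> L_HO z b g (\<lambda>x. h x + \<mu> * g x) \<Longrightarrow>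
      (AE x in lborel. f x = g x)"
    by (auto simp: Sp_def resolvent_set_def)
  have "(\<lambda>x. 0) \<in> L2" by (simp add: L2_def)
  from inj[OF this, of f "\<lambda>x. 0"] have "AE x in lborel. f x = 0"
    using f L_HO_zero[OF b] by simp
  moreover have "continuous_on UNIV f"
    using f by (auto simp: L_HO_def form_dom_HO_def H1_def)
  ultimately show False using continuous_AE_zero nz by blast
qed

text \<open>The Green function ansatz: $f = p\,G(\cdot,b) + q\,G(\cdot,-b)$ with
  $G(x,y)=\psi(\max(x,y))\,\psi(-\min(x,y))$, whose derivative jumps by the Wronskian at $y$.\<close>

lemma eigenvalue_condition:
  assumes b: "b > 0" and w: "wronskian s b \<noteq> 0"
    and char: "(wronskian s b)\<^sup>2 = z\<^sup>2 * ((psi s b)\<^sup>2 * ((psi s (- b))\<^sup>2 - (psi s b)\<^sup>2))"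
  shows "1 - 2 * s \<in> Sp (L_HO z b)"
proof -
  define w where "w = wronskian s b"
  define u where "u = psi s b"
  define v where "v = psi s (- b)"
  have char': "w\<^sup>2 = z\<^sup>2 * (u\<^sup>2 * (v\<^sup>2 - u\<^sup>2))" and w0: "w \<noteq> 0"
    using char w by (simp_all add: w_def u_def v_def)
  \<comment> \<open>The derivative jumps of the ansatz at b and -b are p w and q w. The first two
    conditions are the jump conditions, a homogeneous 2x2 system whose determinant is zero by
    \<open>char'\<close>.\<close>
  obtain p q where pq: "p * w = z * (p * u * v + q * u * u)" "q * w = - z * (p * u * u + q * u * v)" "p \<noteq> 0 \<or> q \<noteq> 0"
  \<comment> \<open>The vector (z u^2, w - z u v) satisfies the first equation identically and the
    second by the determinant; when it is the zero vector, (1, 0) is a solution.\<close>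
  proof (cases "z * u * u = 0 \<and> w = z * u * v")
    case True
    then show ?thesis by (intro that[of 1 0]) (auto simp: algebra_simps)
  next
    case False
    show ?thesis
    proof (rule that[of "z * u * u" "w - z * u * v"])
      show "z * u * u * w = z * (z * u * u * u * v + (w - z * u * v) * u * u)"
        by (simp add: algebra_simps)
      have "(w - z * u * v) * w + z * (z * u * u * u * u + (w - z * u * v) * u * v)
          = w\<^sup>2 - z\<^sup>2 * (u\<^sup>2 * (v\<^sup>2 - u\<^sup>2))"
        by (simp add: algebra_simps power2_eq_square)
      then show "(w - z * u * v) * w = - z * (z * u * u * u * u + (w - z * u * v) * u * v)"
        using char' by (simp add: eq_neg_iff_add_eq_0)
      show "z * u * u \<noteq> 0 \<or> w - z * u * v \<noteq> 0" using False by auto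
    qed
  qed
  \<comment> \<open>The ansatz written out on the three intervals: the outer pieces are multiples of
    psi(-x) and psi(x), which decay at the respective end.\<close>
  define f1 where "f1 = (\<lambda>x. (p * u + q * v) * psi s (- x))"
  define f2 where "f2 = (\<lambda>x. p * u * psi s (- x) + q * u * psi s x)"
  define f3 where "f3 = (\<lambda>x. (p * v + q * u) * psi s x)"
  define d1 where "d1 = (\<lambda>x. (p * u + q * v) * (- psi' s (- x)))"
  define d2 where "d2 = (\<lambda>x. p * u * (- psi' s (- x)) + q * u * psi' s x)"
  define d3 where "d3 = (\<lambda>x. (p * v + q * u) * psi' s x)"
  define Q where "Q = (\<lambda>x::real. (complex_of_real x)\<^sup>2 - (1 - 2 * s))"
  have n: "(uminus has_vector_derivative (-1::real)) (at x)" for x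
    by (auto intro!: derivative_eq_intros)
  have r: "((\<lambda>x. psi s (- x)) has_vector_derivative - psi' s (- x)) (at x)" for x
    using vector_diff_chain_at[OF n psi_derivative] by (simp add: comp_def)
  have r': "((\<lambda>x. - psi' s (- x)) has_vector_derivative Q x * psi s (- x)) (at x)" for x
    using has_vector_derivative_minus[OF vector_diff_chain_at[OF n psi'_derivative]] by (simp add: comp_def Q_def)
  have p': "(psi' s has_vector_derivative Q x * psi s x) (at x)" for x
    using psi'_derivative by (simp add: Q_def)
  obtain C where C: "\<And>x. x \<ge> 0 \<Longrightarrow> norm (psi s x) * (1 + x\<^sup>2)\<^sup>2 \<le> C" "\<And>x. x \<ge> 0 \<Longrightarrow> norm (psi' s x) * (1 + x\<^sup>2)\<^sup>2 \<le> C"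
    using psi_decay[of s] by blast
  define c where "c = norm (p * u + q * v) + norm (p * v + q * u)"
  have scale: "norm (a * y) * (1 + x\<^sup>2)\<^sup>2 \<le> c * C" if "norm y * (1 + x\<^sup>2)\<^sup>2 \<le> C" "norm a \<le> c" for a y :: complex and x :: real
  proof -
    have "norm a * (norm y * (1 + x\<^sup>2)\<^sup>2) \<le> c * C"
      using that by (intro mult_mono) (auto intro: order_trans[OF norm_ge_zero])
    then show ?thesis by (simp add: norm_mult mult.assoc)
  qed
  have ca: "norm (p * u + q * v) \<le> c" "norm (p * v + q * u) \<le> c" by (simp_all add: c_def)
  let ?f = "\<lambda>x. if x < - b then f1 x else if x \<le> b then f2 x else f3 x"
  have wr: "v * psi' s b + u * psi' s (- b) = w" by (simp add: w_def wronskian_def u_def v_def)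
  have "L_HO z b ?f (\<lambda>x. (1 - 2 * s) * ?f x)"
  proof (rule L_HO_piecewise_eigenfunction[OF b, where ?d1.0 = d1 and ?d2.0 = d2 and ?d3.0 = d3 and C = "c * C"])
    show "(f1 has_vector_derivative d1 x) (at x)" for x
      unfolding f1_def d1_def by (intro has_vector_derivative_mult_right r)
    show "(f2 has_vector_derivative d2 x) (at x)" for x
      unfolding f2_def d2_def by (intro has_vector_derivative_add has_vector_derivative_mult_right r psi_derivative)
    show "(f3 has_vector_derivative d3 x) (at x)" for x
      unfolding f3_def d3_def by (intro has_vector_derivative_mult_right psi_derivative)
    have "(d1 has_vector_derivative Q x * f1 x) (at x)" for x
      using has_vector_derivative_mult_right[OF r'[of x], of "p * u + q * v"]
      unfolding f1_def d1_def by (simp only: mult_ac)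
    then show "(d1 has_vector_derivative ((complex_of_real x)\<^sup>2 - (1 - 2 * s)) * f1 x) (at x)" for x
      by (simp add: Q_def)
    have "(d2 has_vector_derivative Q x * f2 x) (at x)" for x
      using has_vector_derivative_add[OF has_vector_derivative_mult_right[OF r'[of x], of "p * u"]
        has_vector_derivative_mult_right[OF p'[of x], of "q * u"]]
      unfolding f2_def d2_def by (simp only: mult_ac distrib_left)
    then show "(d2 has_vector_derivative ((complex_of_real x)\<^sup>2 - (1 - 2 * s)) * f2 x) (at x)" for x
      by (simp add: Q_def)
    have "(d3 has_vector_derivative Q x * f3 x) (at x)" for x
      using has_vector_derivative_mult_right[OF p'[of x], of "p * v + q * u"]
      unfolding f3_def d3_def by (simp only: mult_ac)
    then show "(d3 has_vector_derivative ((complex_of_real x)\<^sup>2 - (1 - 2 * s)) * f3 x) (at x)" for x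
      by (simp add: Q_def)
    show "f1 (- b) = f2 (- b)" "f2 b = f3 b"
      by (simp_all add: f1_def f2_def f3_def u_def v_def algebra_simps)
    have "d3 b - d2 b = p * (v * psi' s b + u * psi' s (- b))"
      by (simp add: d3_def d2_def algebra_simps)
    also have "\<dots> = z * f2 b"
      unfolding wr pq(1) by (simp add: f2_def u_def v_def algebra_simps)
    finally show "d3 b - d2 b = z * f2 b" .
    have "d2 (- b) - d1 (- b) = q * (v * psi' s b + u * psi' s (- b))"
      by (simp add: d1_def d2_def algebra_simps)
    also have "\<dots> = - z * f2 (- b)"
      unfolding wr pq(2) by (simp add: f2_def u_def v_def algebra_simps)
    finally show "d2 (- b) - d1 (- b) = - z * f2 (- b)" .
    show "norm (f1 x) * (1 + x\<^sup>2)\<^sup>2 \<le> c * C" "norm (d1 x) * (1 + x\<^sup>2)\<^sup>2 \<le> c * C" if "x \<le> - b" for x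
      unfolding f1_def d1_def using C[of "- x"] that b by (intro scale ca; simp)+
    show "norm (f3 x) * (1 + x\<^sup>2)\<^sup>2 \<le> c * C" "norm (d3 x) * (1 + x\<^sup>2)\<^sup>2 \<le> c * C" if "x \<ge> b" for x
      unfolding f3_def d3_def using C[of x] that b by (intro scale ca; simp)+
  qed
  \<comment> \<open>The jump conditions show that f(b) and f(-b) cannot both vanish, as w is nonzero
    and (p, q) is not the zero vector.\<close>
  moreover have "z * f2 b = p * w" "z * f2 (- b) = - (q * w)"
    by (simp_all add: pq(1,2) f2_def u_def v_def algebra_simps)
  then have "f2 b \<noteq> 0 \<or> f2 (- b) \<noteq> 0" using pq(3) w0 by auto
  then have "?f b \<noteq> 0 \<or> ?f (- b) \<noteq> 0" using b by auto
  ultimately show ?thesis using eigenvalue_in_Sp[OF b] by blast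
qed

text \<open>At x = 0 the recurrence reads \<open>pcf s 0\<close> = (s + 1)/2 times
  \<open>pcf (s + 2) 0\<close>, with a nonzero factor off the integers. Positivity for s > 0 thus
  propagates to the left as non-vanishing.\<close>

lemma pcf_zero_nonzero:
  assumes "a \<notin> \<int>" shows "pcf (of_real a) 0 \<noteq> 0"
proof -
  have "pcf (of_real a) 0 \<noteq> 0" if "a > - real n" "a \<notin> \<int>" for n
    using that
  proof (induction n arbitrary: a rule: less_induct)
    case (less n)
    show ?case
    proof (cases "a > 0")
      case True
      then show ?thesis using pcf_pos[of a 0] by auto
    next
      case False
      then have "n \<noteq> 0" using less.prems by (intro notI) auto
      have i: "a + 1 \<notin> \<int>" "a + 2 \<notin> \<int>" using less.prems by simp_all
      have "pcf (of_real (a + 2)) 0 \<noteq> 0"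
      proof (rule less.IH[of "n - 1"])
        show "a + 2 > - real (n - 1)" using less.prems \<open>n \<noteq> 0\<close> by (simp add: of_nat_diff)
      qed (use \<open>n \<noteq> 0\<close> i in auto)
      moreover have "complex_of_real (a + 1) \<noteq> 0" using i(1) by (metis Ints_0 of_real_eq_0_iff)
      ultimately show ?thesis using pcf_rec[of "of_real a" 0] by auto
    qed
  qed
  moreover obtain n where "a > - real n" by (rule ex_nat_gt_neg)
  ultimately show ?thesis using assms by blast
qed

text \<open>At x = 0 the Wronskian is 2 psi(0) psi'(0), and psi'(0) is -s times
  \<open>pcf (s + 1) 0\<close>.\<close>

lemma wronskian_nonzero:
  assumes "a \<notin> \<int>" shows "wronskian (of_real a) x \<noteq> 0"
proof -
  have "psi (of_real a) 0 \<noteq> 0"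
    using pcf_zero_nonzero[OF assms] by (simp add: psi_def)
  moreover have "a + 1 \<notin> \<int>" using assms by simp
  then have "pcf (of_real a + 1) 0 \<noteq> 0" using pcf_zero_nonzero[of "a + 1"] by simp
  then have "psi' (of_real a) 0 \<noteq> 0" using assms by (auto simp: psi'_def)
  ultimately show ?thesis
    unfolding wronskian_const[of _ x] by (simp add: wronskian_def)
qed

text \<open>If all products of neighbours are non-negative from some index on, then every large $n$ with
  $a_n\neq0$ has $a_{n+1}=0$ and $a_{n+2}\neq 0$, hence also $a_{n+3}=0$; but $a_{n+3}=b\,a_{n+2}$.\<close>

lemma recurrence_sign_changes:
  fixes a :: "nat \<Rightarrow> real"
  assumes b: "b > 0" and rec: "\<And>n. a (n + 2) = b * a (n + 1) - (real n + 1) / 2 * a n" and a0: "a 0 \<noteq> 0"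
  shows "infinite {n. a n * a (n + 1) < 0}"
proof
  assume fin: "finite {n. a n * a (n + 1) < 0}"
  obtain N where N: "\<And>n. a n * a (n + 1) < 0 \<Longrightarrow> n < N"
    using finite_nat_set_iff_bounded[THEN iffD1, OF fin] by auto
  \<comment> \<open>From index M on, b^2 < (n + 2)/2, the inequality that fixes the sign in
    \<open>gap\<close>.\<close>
  obtain M where M: "2 * b\<^sup>2 < real M" using reals_Archimedean2 by blast
  define m0 where "m0 = max N M"
  have nonneg: "a n * a (n + 1) \<ge> 0" if "n \<ge> m0" for n
    using N[of n] that by (auto simp: m0_def not_less[symmetric])
  have no_two: "a n \<noteq> 0 \<or> a (n + 1) \<noteq> 0" for n
  proof (induction n)
    case (Suc n)
    then show ?case using rec[of n] by auto
  qed (use a0 in simp)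
  have gap: "a (n + 2) = 0 \<and> a (n + 3) \<noteq> 0" if n: "n \<ge> m0" and nz: "a (n + 1) \<noteq> 0" for n
  proof -
    have r2: "a (n + 2) = b * a (n + 1) - (real n + 1) / 2 * a n" by (rule rec)
    have r3: "a (n + 3) = b * a (n + 2) - (real n + 2) / 2 * a (n + 1)"
      using rec[of "n + 1"] by (simp add: numeral_3_eq_3 algebra_simps)
    \<comment> \<open>Eliminating a(n+2) leaves a negative multiple of a(n+1)^2 minus a nonnegative
      term, so a(n+1) and a(n+3) have strictly opposite signs. As a(n+2) has nonnegative product
      with both, it must vanish.\<close>
    have "a (n + 1) * a (n + 3) = (b\<^sup>2 - (real n + 2) / 2) * (a (n + 1))\<^sup>2 - b * (real n + 1) / 2 * (a n * a (n + 1))"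
      unfolding r3 r2 by (simp add: algebra_simps power2_eq_square)
    also have "\<dots> \<le> (b\<^sup>2 - (real n + 2) / 2) * (a (n + 1))\<^sup>2"
      using nonneg[OF n] b by simp
    also have "\<dots> < 0"
    proof (rule mult_neg_pos)
      have "real M \<le> real n" using n by (simp add: m0_def)
      then show "b\<^sup>2 - (real n + 2) / 2 < 0" using M by simp
    qed (use nz in simp)
    finally have neg: "a (n + 1) * a (n + 3) < 0" .
    have "a (n + 1) * a (n + 2) \<ge> 0" "a (n + 2) * a (n + 3) \<ge> 0"
      using nonneg[of "n + 1"] nonneg[of "n + 2"] n by (simp_all add: numeral_2_eq_2 numeral_3_eq_3)
    then have "0 \<le> (a (n + 1) * a (n + 2)) * (a (n + 2) * a (n + 3))" by (rule mult_nonneg_nonneg)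
    also have "\<dots> = (a (n + 1) * a (n + 3)) * (a (n + 2))\<^sup>2" by (simp add: power2_eq_square)
    finally have "\<not> (a (n + 1) * a (n + 3)) * (a (n + 2))\<^sup>2 < 0" by simp
    then have "a (n + 2) = 0" using mult_neg_pos[OF neg, of "(a (n + 2))\<^sup>2"] by auto
    then show ?thesis using neg by auto
  qed
  \<comment> \<open>Two neighbours never vanish together, so n can be taken as m0 or m0 + 1.\<close>
  obtain n where n: "n \<ge> m0" "a (n + 1) \<noteq> 0"
    using no_two[of "m0 + 1"] by (metis add.commute le_add2 le_refl trans_le_add1)
  have "a (n + 2) = 0" "a (n + 3) \<noteq> 0" using gap[OF n] by auto
  moreover have "a (n + 4) = 0" using gap[of "n + 2"] n \<open>a (n + 3) \<noteq> 0\<close> by (simp add: eval_nat_numeral)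
  moreover have "a (n + 4) = b * a (n + 3) - (real (n + 2) + 1) / 2 * a (n + 2)"
    using rec[of "n + 2"] by (simp add: eval_nat_numeral)
  ultimately show False using b by simp
qed

text \<open>At s = -n - 2 the recurrence in s becomes the real three-term recurrence of the monic
  Hermite polynomials at b.\<close>

lemma pcf_sign_changes:
  assumes "b > 0"
  shows "infinite {n. Re (pcf (- of_nat n) (of_real b)) * Re (pcf (- of_nat (n + 1)) (of_real b)) < 0}"
proof -
  define a where "a = (\<lambda>n. Re (pcf (of_real (- real n)) (of_real b)))"
  have "a (n + 2) = b * a (n + 1) - (real n + 1) / 2 * a n" for n
  proof -
    have "pcf (of_real (- real (n + 2))) (of_real b)
        = of_real b * pcf (of_real (- real (n + 1))) (of_real b) + of_real (- (real n + 1) / 2) * pcf (of_real (- real n)) (of_real b)"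
      using pcf_rec[of "of_real (- real (n + 2))" "of_real b"] by (simp add: algebra_simps)
    then have "a (n + 2) = b * a (n + 1) + (- (real n + 1) / 2) * a n"
      by (simp only: a_def plus_complex.simps times_complex.simps Re_complex_of_real Im_complex_of_real
          mult_zero_left diff_zero)
    then show ?thesis by (simp add: field_simps)
  qed
  moreover have "a 0 \<noteq> 0"
  proof -
    \<comment> \<open>Positivity is known only for s > 0; one step of the recurrence writes the
      value at 0 as a positive combination of those at 1 and 2.\<close>
    have "pcf 0 (of_real b) = of_real b * pcf (of_real 1) (of_real b) + of_real (1 / 2) * pcf (of_real 2) (of_real b)"
      using pcf_rec[of 0 "of_real b"] by simp
    then have "a 0 = b * Re (pcf (of_real 1) (of_real b)) + 1 / 2 * Re (pcf (of_real 2) (of_real b))"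
      by (simp add: a_def)
    also have "\<dots> > 0"
      using pcf_pos[of 1 b] pcf_pos[of 2 b] assms by (intro add_pos_pos mult_pos_pos) auto
    finally show ?thesis by simp
  qed
  ultimately have "infinite {n. a n * a (n + 1) < 0}"
    by (rule recurrence_sign_changes[OF assms])
  then show ?thesis by (simp add: a_def)
qed

text \<open>The intermediate value theorem yields a zero in the closed interval, and the strict sign
  change excludes the endpoints, so a is not an integer.\<close>

lemma psi_zero_between:
  assumes "Re (pcf (- of_nat n) (of_real b)) * Re (pcf (- of_nat (n + 1)) (of_real b)) < 0"
  obtains a where "- real n - 1 < a" "a < - real n" "psi (of_real a) b = 0"
proof -
  define h where "h = (\<lambda>a. Re (pcf (of_real a) (of_real b)))"
  have cont: "continuous_on S h" for S
    unfolding h_def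
    by (intro continuous_intros continuous_on_compose2[OF holomorphic_on_imp_continuous_on[OF pcf_holomorphic]]) auto
  have e: "- of_nat n = complex_of_real (- real n)" "- of_nat (n + 1) = complex_of_real (- real n - 1)"
    by simp_all
  have sgn: "h (- real n) * h (- real n - 1) < 0" using assms unfolding h_def e .
  have "\<exists>a. - real n - 1 \<le> a \<and> a \<le> - real n \<and> h a = 0"
  proof (cases "h (- real n) > 0")
    case True
    then show ?thesis
      using sgn by (intro IVT') (auto intro: cont simp: mult_less_0_iff)
  next
    case False
    then show ?thesis
      using sgn by (intro IVT2') (auto intro: cont simp: mult_less_0_iff)
  qed
  then obtain a where a: "- real n - 1 \<le> a" "a \<le> - real n" "h a = 0" by blast
  moreover have "a \<noteq> - real n - 1" "a \<noteq> - real n" using a(3) sgn by auto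
  moreover have "pcf (of_real a) (of_real b) = 0"
    using a(3) pcf_real[of a b] by (auto simp: h_def complex_is_Real_iff complex_eq_iff)
  ultimately show ?thesis by (intro that[of a]) (auto simp: psi_def)
qed

section \<open>Non-real eigenvalues near zeros of $\psi(b)$\<close>

lemma nonreal_root_near_zero:
  assumes b: "b > 0" and a: "a \<notin> \<int>" and zero: "psi (of_real a) b = 0" and \<delta>: "\<delta> > 0"
  shows "\<forall>\<^sub>F r in at_top. \<exists>s\<in>ball (of_real a) \<delta>. s \<notin> \<real> \<and> 1 - 2 * s \<in> Sp (L_HO (\<i> * of_real r) b)"
proof -
  define W where "W = (\<lambda>s. wronskian s b)"
  define P where "P = (\<lambda>s. (psi s b)\<^sup>2 * ((psi s (- b))\<^sup>2 - (psi s b)\<^sup>2))"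
  have holW: "W holomorphic_on UNIV" unfolding W_def wronskian_def
    by (intro holomorphic_intros psi_holomorphic psi'_holomorphic)
  have holP: "P holomorphic_on UNIV" unfolding P_def
    by (intro holomorphic_intros psi_holomorphic)
  have contW: "continuous_on S W" and contP: "continuous_on S P" for S
    using holomorphic_on_imp_continuous_on[OF holW] holomorphic_on_imp_continuous_on[OF holP]
    by (auto intro: continuous_on_subset)
  have cpsi: "isCont (\<lambda>s. psi s x) s" for x s
    using holomorphic_on_imp_continuous_on[OF psi_holomorphic] by (simp add: continuous_on_eq_continuous_at)
  let ?a = "complex_of_real a"
  have Wa: "W ?a \<noteq> 0" unfolding W_def by (rule wronskian_nonzero[OF a])
  then have "psi ?a (- b) \<noteq> 0" using zero by (auto simp: W_def wronskian_def)
  \<comment> \<open>This strict inequality persists near a and serves twice: together with psi(b)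
    \<noteq> 0 it keeps P nonzero on a small circle, and at real s it makes P nonnegative.\<close>
  then have "norm (psi ?a b) < norm (psi ?a (- b))" using zero by simp
  moreover have "(\<lambda>s. norm (psi s (- b)) - norm (psi s b)) \<midarrow>?a\<rightarrow> norm (psi ?a (- b)) - norm (psi ?a b)"
    using cpsi by (intro tendsto_intros) (auto simp: isCont_def)
  ultimately have "\<forall>\<^sub>F s in at ?a. 0 < norm (psi s (- b)) - norm (psi s b)"
    by (intro order_tendstoD(1)) auto
  moreover have "\<forall>\<^sub>F s in at ?a. W s \<noteq> 0"
    using contW[of UNIV] Wa by (intro tendsto_imp_eventually_ne) (auto simp: continuous_on_eq_continuous_at isCont_def)
  moreover have "\<forall>\<^sub>F s in at ?a. psi s b \<noteq> 0"
  proof -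
    \<comment> \<open>So psi(b) is not identically zero in s, and its zero at a is isolated.\<close>
    have "psi 1 b \<noteq> 0" using pcf_pos[of 1 b] by (auto simp: psi_def)
    then obtain r where "r > 0" "\<And>s. s \<in> ball ?a r - {?a} \<Longrightarrow> psi s b \<noteq> 0"
      using isolated_zeros[OF psi_holomorphic open_UNIV connected_UNIV UNIV_I zero UNIV_I] by metis
    then show ?thesis unfolding eventually_at by (intro exI[of _ r]) (auto simp: dist_commute)
  qed
  ultimately have "\<forall>\<^sub>F s in at ?a. norm (psi s b) < norm (psi s (- b)) \<and> W s \<noteq> 0 \<and> psi s b \<noteq> 0"
    by eventually_elim auto
  then obtain d where d: "d > 0" "\<And>s. s \<noteq> ?a \<Longrightarrow> dist s ?a < d \<Longrightarrow>
      norm (psi s b) < norm (psi s (- b)) \<and> W s \<noteq> 0 \<and> psi s b \<noteq> 0"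
    unfolding eventually_at by blast
  define e where "e = min d \<delta> / 2"
  have e: "e > 0" "e < d" "e < \<delta>" using d(1) \<delta> by (auto simp: e_def)
  have near: "norm (psi s b) < norm (psi s (- b))" "W s \<noteq> 0" if "s \<in> cball ?a e" for s
    using d(2)[of s] that e Wa zero \<open>psi ?a (- b) \<noteq> 0\<close> by (cases "s = ?a"; force simp: dist_commute)+
  have P_sphere: "P s \<noteq> 0" if "s \<in> sphere ?a e" for s
  proof -
    have "s \<noteq> ?a" "dist s ?a < d" using that e by (auto simp: dist_commute)
    then have *: "norm (psi s b) < norm (psi s (- b))" "psi s b \<noteq> 0" using d(2) by auto
    then have "(psi s (- b))\<^sup>2 \<noteq> (psi s b)\<^sup>2" by (metis less_irrefl norm_minus_cancel power2_eq_iff)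
    then show ?thesis using * by (simp add: P_def)
  qed
  \<comment> \<open>With m a lower bound of |P| on the circle and M an upper bound of |W^2| on the
    disc, r^2 m > 2 M gives |H(a)| \<le> M < r^2 m - M \<le> |H| on the circle, because P(a) =
    0.\<close>
  obtain m where m: "m > 0" "\<And>s. s \<in> sphere ?a e \<Longrightarrow> m \<le> norm (P s)"
  proof -
    have "\<exists>s0\<in>sphere ?a e. \<forall>s\<in>sphere ?a e. norm (P s0) \<le> norm (P s)"
      using e by (intro continuous_attains_inf continuous_intros contP) auto
    then obtain s0 where "s0 \<in> sphere ?a e" "\<And>s. s \<in> sphere ?a e \<Longrightarrow> norm (P s0) \<le> norm (P s)" by blast
    then show ?thesis using P_sphere[of s0] by (intro that[of "norm (P s0)"]) auto
  qed
  obtain M where M: "\<And>s. s \<in> cball ?a e \<Longrightarrow> norm ((W s)\<^sup>2) \<le> M"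
  proof -
    have "bounded ((\<lambda>s. (W s)\<^sup>2) ` cball ?a e)"
      by (intro compact_imp_bounded compact_continuous_image continuous_intros contW) auto
    then show ?thesis using that unfolding bounded_iff by blast
  qed
  have "\<forall>\<^sub>F r::real in at_top. r > 0" by (rule eventually_gt_at_top)
  moreover have "\<forall>\<^sub>F r::real in at_top. 2 * M / m < r\<^sup>2"
    by (rule filterlim_at_top_dense[THEN iffD1, rule_format]) real_asymp
  ultimately show ?thesis
  proof eventually_elim
    case (elim r)
    \<comment> \<open>For z = i r the eigenvalue condition is H = 0, since z^2 = -r^2.\<close>
    define H where "H = (\<lambda>s. (W s)\<^sup>2 + (of_real r)\<^sup>2 * P s)"
    have Pa: "P ?a = 0" by (simp add: P_def zero)
    have rm: "2 * M < r\<^sup>2 * m" using elim m(1) by (simp add: divide_less_eq)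
    obtain s where s: "s \<in> ball ?a e" "H s = 0"
    proof (rule holomorphic_contract_to_zero[of ?a e H])
      show "continuous_on (cball ?a e) H" unfolding H_def by (intro continuous_intros contW contP)
      show "H holomorphic_on ball ?a e" unfolding H_def
        by (intro holomorphic_intros holomorphic_on_subset[OF holW] holomorphic_on_subset[OF holP]) auto
      fix y assume y: "norm (?a - y) = e"
      then have ys: "y \<in> sphere ?a e" "y \<in> cball ?a e" by (auto simp: dist_norm)
      have "norm (H ?a) \<le> M" using M[of ?a] e by (simp add: H_def Pa)
      also have "M < r\<^sup>2 * m - M" using rm by simp
      also have "\<dots> \<le> norm ((of_real r)\<^sup>2 * P y) - norm ((W y)\<^sup>2)"
        using M[OF ys(2)] mult_left_mono[OF m(2)[OF ys(1)], of "r\<^sup>2"] by (simp add: norm_mult norm_power)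
      also have "\<dots> \<le> norm (H y)"
        unfolding H_def using norm_diff_ineq[of "(of_real r)\<^sup>2 * P y" "(W y)\<^sup>2"] by (simp add: add.commute)
      finally show "norm (H ?a) < norm (H y)" .
    qed (use e in auto)
    have sc: "s \<in> cball ?a e" using s by auto
    have "s \<notin> \<real>"
    proof
      assume "s \<in> \<real>"
      then obtain c where c: "s = of_real c" by (elim Reals_cases)
      have "psi s b \<in> \<real>" "psi s (- b) \<in> \<real>" "W s \<in> \<real>"
        unfolding c W_def wronskian_def by (auto intro!: Reals_add Reals_mult psi_real)
      then obtain u v w where uvw: "psi s b = of_real u" "psi s (- b) = of_real v" "W s = of_real w"
        by (auto elim!: Reals_cases)
      have "H s = of_real (w\<^sup>2 + r\<^sup>2 * (u\<^sup>2 * (v\<^sup>2 - u\<^sup>2)))" by (simp add: H_def P_def uvw)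
      then have "w\<^sup>2 + r\<^sup>2 * (u\<^sup>2 * (v\<^sup>2 - u\<^sup>2)) = 0" using s(2) by (metis of_real_eq_0_iff)
      moreover have "w \<noteq> 0" using near(2)[OF sc] uvw by auto
      moreover have "u\<^sup>2 \<le> v\<^sup>2" using near(1)[OF sc] uvw by (auto simp: abs_le_square_iff[symmetric])
      then have "0 \<le> r\<^sup>2 * (u\<^sup>2 * (v\<^sup>2 - u\<^sup>2))" by simp
      ultimately show False by (smt (verit) zero_less_power2)
    qed
    moreover have "1 - 2 * s \<in> Sp (L_HO (\<i> * of_real r) b)"
    proof (rule eigenvalue_condition[OF b])
      show "wronskian s b \<noteq> 0" using near(2)[OF sc] by (simp add: W_def)
      show "(wronskian s b)\<^sup>2 = (\<i> * complex_of_real r)\<^sup>2 * ((psi s b)\<^sup>2 * ((psi s (- b))\<^sup>2 - (psi s b)\<^sup>2))"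
        using s(2) by (simp add: H_def W_def P_def power_mult_distrib eq_neg_iff_add_eq_0)
    qed
    moreover have "s \<in> ball ?a \<delta>" using s e by auto
    ultimately show ?case by blast
  qed
qed

theorem theorem1:
  fixes b :: real
  assumes "b > 0"
  shows "(N_HO b \<longlongrightarrow> \<infinity>) at_top"
proof (rule order_tendstoI)
  fix y :: enat assume "y < \<infinity>"
  then obtain k where k: "y = enat k" by (cases y) auto
  define N where "N = {n. Re (pcf (- of_nat n) (of_real b)) * Re (pcf (- of_nat (n + 1)) (of_real b)) < 0}"
  have "infinite N" unfolding N_def by (rule pcf_sign_changes[OF assms])
  \<comment> \<open>Taking k + 1 indices, because the count has to exceed k strictly.\<close>
  then obtain A where A: "finite A" "card A = Suc k" "A \<subseteq> N" using infinite_arbitrarily_large by blast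
  define good where "good = (\<lambda>r n s. - real n - 1 < Re s \<and> Re s < - real n \<and> s \<notin> \<real> \<and> 1 - 2 * s \<in> Sp (L_HO (\<i> * of_real r) b))"
  have "\<forall>\<^sub>F r in at_top. \<exists>s. good r n s" if nA: "n \<in> A" for n
  proof -
    obtain a where a: "- real n - 1 < a" "a < - real n" "psi (of_real a) b = 0"
    proof (rule psi_zero_between)
      have "n \<in> N" using nA A(3) by blast
      then show "Re (pcf (- of_nat n) (of_real b)) * Re (pcf (- of_nat (n + 1)) (of_real b)) < 0"
        by (simp only: N_def mem_Collect_eq)
    qed
    have "a \<notin> \<int>"
    proof
      assume "a \<in> \<int>"
      then obtain i where i: "a = of_int i" by (elim Ints_cases)
      have "real_of_int (- int n - 1) < of_int i" "real_of_int i < of_int (- int n)"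
        using a(1,2) by (simp_all add: i)
      then show False unfolding of_int_less_iff by linarith
    qed
    \<comment> \<open>The largest radius for which |Re s - a| < \<delta> keeps Re s inside (-n-1,
      -n).\<close>
    define \<delta> where "\<delta> = min (a + real n + 1) (- real n - a)"
    have \<delta>: "\<delta> > 0" using a by (simp add: \<delta>_def)
    show ?thesis
      using nonreal_root_near_zero[OF assms \<open>a \<notin> \<int>\<close> a(3) \<delta>]
    proof eventually_elim
      case (elim r)
      then obtain s where s: "s \<in> ball (of_real a) \<delta>" "s \<notin> \<real>" "1 - 2 * s \<in> Sp (L_HO (\<i> * of_real r) b)" by blast
      have "\<bar>Re s - a\<bar> < \<delta>"
        using s(1) abs_Re_le_cmod[of "s - of_real a"] by (simp add: dist_norm norm_minus_commute)
      then have "- real n - 1 < Re s" "Re s < - real n" by (auto simp: \<delta>_def)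
      with s show ?case unfolding good_def by blast
    qed
  qed
  \<comment> \<open>The threshold for r depends on n; finiteness of A provides a common one.\<close>
  then have "\<forall>\<^sub>F r in at_top. \<forall>n\<in>A. \<exists>s. good r n s"
    by (intro eventually_ball_finite A(1)) auto
  then show "\<forall>\<^sub>F r in at_top. y < N_HO b r"
  proof eventually_elim
    case (elim r)
    then obtain s where s: "\<And>n. n \<in> A \<Longrightarrow> good r n (s n)" by metis
    let ?S = "Sp (L_HO (\<i> * of_real r) b) - \<real>"
    \<comment> \<open>The real parts of the chosen s lie in pairwise disjoint intervals (-n-1,
      -n).\<close>
    have inj: "inj_on (\<lambda>n. 1 - 2 * s n) A"
    proof (rule inj_onI)
      fix n m assume nm: "n \<in> A" "m \<in> A" "1 - 2 * s n = 1 - 2 * s m"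
      then have "Re (s n) = Re (s m)" by simp
      moreover have "- real n - 1 < Re (s n)" "Re (s n) < - real n" "- real m - 1 < Re (s m)" "Re (s m) < - real m"
        using s[OF nm(1)] s[OF nm(2)] unfolding good_def by blast+
      ultimately have "- real n - 1 < - real m" "- real m - 1 < - real n" by linarith+
      then show "n = m" by linarith
    qed
    have sub: "(\<lambda>n. 1 - 2 * s n) ` A \<subseteq> ?S"
    proof (intro image_subsetI DiffI)
      fix n assume "n \<in> A"
      note g = s[OF this, unfolded good_def]
      show "1 - 2 * s n \<in> Sp (L_HO (\<i> * of_real r) b)" using g by blast
      show "1 - 2 * s n \<notin> \<real>" using g by (simp add: complex_is_Real_iff)
    qed
    show ?case
    proof (cases "finite ?S")
      case True
      then have "Suc k \<le> card ?S" using card_mono[OF True sub] card_image[OF inj] A(2) by simp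
      then show ?thesis using True by (simp add: N_HO_def ecard_def k)
    qed (simp add: N_HO_def ecard_def k)
  qed
\<comment> \<open>No extended natural number lies above \<infinity>, so the other half of the order
  criterion is vacuous.\<close>
qed simp

end
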